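(* If $(g,\xi,\lambda)$ is a Ricci soliton on an invariant submanifold $M$ of a generalized Sasakian-space-form $\overline{M}^{2n+1}(f_1,f_2,f_3)$, then $M$ is Einstein.
   Context: An almost contact metric manifold $(\overline M,\phi,\xi,\eta,g)$ is a Riemannian manifold $(\overline M,g)$ with a $(1,1)$-tensor field $\phi$, a vector field $\xi$ and a $1$-form $\eta$ such that $\phi^2X=-X+\eta(X)\xi$, $\phi\xi=0$, $\eta(\xi)=1$, $g(X,\xi)=\eta(X)$, $\eta(\phi X)=0$, $g(\phi X,\phi Y)=g(X,Y)-\eta(X)\eta(Y)$. Curvature convention: $R(X,Y)=[\nabla_X,\nabla_Y]-\nabla_{[X,Y]}$. A generalized Sasakian-space-form $\overline M^{2n+1}(f_1,f_2,f_3)$ is an almost contact metric manifold of dimension $2n+1$, $n>1$, with smooth functions $f_1,f_2,f_3$ on $\overline M$ such that the curvature tensor $\overline R$ of its Levi-Civita connection $\overline\nabla$ satisfies $\overline R(X,Y)Z=f_1\{g(Y,Z)X-g(X,Z)Y\}+f_2\{g(X,\phi Z)\phi Y-g(Y,\phi Z)\phi X+2g(X,\phi Y)\phi Z\}+f_3\{\eta(X)\eta(Z)Y-\eta(Y)\eta(Z)X+g(X,Z)\eta(Y)\xi-g(Y,Z)\eta(X)\xi\}.$ Throughout, the following structure equations also hold on $\overline M$: $(\overline\nabla_X\phi)(Y)=(f_1-f_3)[g(X,Y)\xi-\eta(Y)X]$ and $\overline\nabla_X\xi=-(f_1-f_3)\phi X$. A submanifold $M$ of $\overline M$ is invariant if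 $\xi$ is tangent to $M$ and $\phi(TM)\subset TM$ at every point of $M$. $M$ carries the induced metric (still denoted $g$), with Ricci tensor $S$. $(g,\xi,\lambda)$ is a Ricci soliton on $M$ if $\lambda$ is a real number and $(\mathcal{L}_\xi g)(Y,Z)+2S(Y,Z)+2\lambda g(Y,Z)=0$ for all $Y,Z$ tangent to $M$, where $\mathcal L_\xi$ is the Lie derivative along $\xi$. $M$ is Einstein if $S=c\,g$ for a constant $c$. *)

theory Defs
  imports "HOL-Analysis.Analysis" "HOL-Library.Function_Algebras"
begin

text \<open>
  The distribution has no smooth manifolds, so the basic vocabulary is set up here. A manifold is
  a whole Hausdorff second countable type \<open>'a\<close> with a smooth atlas of charts into a Euclidean
  space \<open>'e\<close>; its dimension is \<open>DIM('e)\<close>. Tangent vectors are derivations of the algebra of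
  globally defined smooth functions; tensor fields act pointwise on tangent vectors.
\<close>

subsection \<open>Functions as a real vector space\<close>

instantiation "fun" :: (type, real_vector) real_vector
begin

definition scaleR_fun_def: "a *\<^sub>R f = (\<lambda>x. a *\<^sub>R f x)"

instance
  by standard (simp_all add: scaleR_fun_def fun_eq_iff scaleR_add_left scaleR_add_right)

end

lemma scaleR_fun_apply [simp]: "(a *\<^sub>R f) x = a *\<^sub>R f x"
  by (simp add: scaleR_fun_def)

subsection \<open>Smooth manifolds\<close>

text \<open>Only used on open sets \<open>S\<close> of a Euclidean space.\<close>

primrec Ck_on ::
    "nat \<Rightarrow> 'e::euclidean_space set \<Rightarrow> ('e \<Rightarrow> 'c::real_normed_vector) \<Rightarrow> bool" where
  "Ck_on 0 S f \<longleftrightarrow> continuous_on S f"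
| "Ck_on (Suc k) S f \<longleftrightarrow> (\<forall>x\<in>S. f differentiable (at x)) \<and>
     (\<forall>v. Ck_on k S (\<lambda>x. frechet_derivative f (at x) v))"

definition smooth_on :: "'e::euclidean_space set \<Rightarrow> ('e \<Rightarrow> 'c::real_normed_vector) \<Rightarrow> bool" where
  "smooth_on S f \<longleftrightarrow> (\<forall>k. Ck_on k S f)"

type_synonym ('a, 'e) atlas = "('a set \<times> ('a \<Rightarrow> 'e)) set"

definition smooth_atlas ::
    "('a::{t2_space, second_countable_topology}, 'e::euclidean_space) atlas \<Rightarrow> bool" where
  "smooth_atlas A \<longleftrightarrow>
     (\<forall>(U, c)\<in>A. open U \<and> open (c ` U) \<and> (\<exists>d. homeomorphism U (c ` U) c d)) \<and>
     (\<Union>(U, c)\<in>A. U) = UNIV \<and>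
     (\<forall>(U, c)\<in>A. \<forall>(V, d)\<in>A. smooth_on (c ` (U \<inter> V)) (d \<circ> inv_into U c))"

definition smooth_fun :: "('a, 'e::euclidean_space) atlas \<Rightarrow> ('a \<Rightarrow> real) \<Rightarrow> bool" where
  "smooth_fun A f \<longleftrightarrow> (\<forall>(U, c)\<in>A. smooth_on (c ` U) (f \<circ> inv_into U c))"

definition smooth_map :: "('b::topological_space, 'd::euclidean_space) atlas \<Rightarrow>
    ('a::topological_space, 'e::euclidean_space) atlas \<Rightarrow> ('b \<Rightarrow> 'a) \<Rightarrow> bool" where
  "smooth_map B A \<iota> \<longleftrightarrow> continuous_on UNIV \<iota> \<and>
     (\<forall>(U, c)\<in>B. \<forall>(V, d)\<in>A. smooth_on (c ` (U \<inter> \<iota> -` V)) (d \<circ> \<iota> \<circ> inv_into U c))"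

subsection \<open>Tangent vectors and vector fields\<close>

type_synonym 'a tangent = "('a \<Rightarrow> real) \<Rightarrow> real"
type_synonym 'a vfield = "'a \<Rightarrow> 'a tangent"

text \<open>Derivations at \<open>p\<close>, set to \<open>0\<close> on non-smooth functions so that equality of tangent
  vectors is equality in HOL.\<close>

definition tangent_space :: "('a, 'e::euclidean_space) atlas \<Rightarrow> 'a \<Rightarrow> 'a tangent set" where
  "tangent_space A p = {v.
     (\<forall>f. \<not> smooth_fun A f \<longrightarrow> v f = 0) \<and>
     (\<forall>f h a b. smooth_fun A f \<longrightarrow> smooth_fun A h \<longrightarrow>
        v (\<lambda>x. a * f x + b * h x) = a * v f + b * v h) \<and>
     (\<forall>f h. smooth_fun A f \<longrightarrow> smooth_fun A h \<longrightarrow>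
        v (\<lambda>x. f x * h x) = f p * v h + h p * v f)}"

definition vector_field :: "('a, 'e::euclidean_space) atlas \<Rightarrow> 'a vfield \<Rightarrow> bool" where
  "vector_field A X \<longleftrightarrow> (\<forall>p. X p \<in> tangent_space A p) \<and>
     (\<forall>f. smooth_fun A f \<longrightarrow> smooth_fun A (\<lambda>p. X p f))"

definition lie_bracket :: "'a vfield \<Rightarrow> 'a vfield \<Rightarrow> 'a vfield" where
  "lie_bracket X Y = (\<lambda>p f. X p (\<lambda>q. Y q f) - Y p (\<lambda>q. X q f))"

text \<open>The differential of \<open>\<iota>\<close>; the base point is implicit in the tangent vector.\<close>

definition pushforward ::
    "('a, 'e::euclidean_space) atlas \<Rightarrow> ('b \<Rightarrow> 'a) \<Rightarrow> 'b tangent \<Rightarrow> 'a tangent" where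
  "pushforward A \<iota> v = (\<lambda>f. if smooth_fun A f then v (f \<circ> \<iota>) else 0)"

definition immersion :: "('b::topological_space, 'd::euclidean_space) atlas \<Rightarrow>
    ('a::topological_space, 'e::euclidean_space) atlas \<Rightarrow> ('b \<Rightarrow> 'a) \<Rightarrow> bool" where
  "immersion B A \<iota> \<longleftrightarrow> smooth_map B A \<iota> \<and>
     (\<forall>q. inj_on (pushforward A \<iota>) (tangent_space B q))"

definition linear_on_space :: "'v::real_vector set \<Rightarrow> ('v \<Rightarrow> 'w::real_vector) \<Rightarrow> bool" where
  "linear_on_space V L \<longleftrightarrow>
     (\<forall>v\<in>V. \<forall>w\<in>V. L (v + w) = L v + L w) \<and> (\<forall>a. \<forall>v\<in>V. L (a *\<^sub>R v) = a *\<^sub>R L v)"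

subsection \<open>Riemannian metrics, connections, curvature\<close>

type_synonym 'a metric_tensor = "'a \<Rightarrow> 'a tangent \<Rightarrow> 'a tangent \<Rightarrow> real"
type_synonym 'a connection = "'a vfield \<Rightarrow> 'a vfield \<Rightarrow> 'a vfield"

definition riemannian_metric ::
    "('a, 'e::euclidean_space) atlas \<Rightarrow> 'a metric_tensor \<Rightarrow> bool" where
  "riemannian_metric A g \<longleftrightarrow>
     (\<forall>p. \<forall>v\<in>tangent_space A p. linear_on_space (tangent_space A p) (g p v)) \<and>
     (\<forall>p. \<forall>v\<in>tangent_space A p. \<forall>w\<in>tangent_space A p. g p v w = g p w v) \<and>
     (\<forall>p. \<forall>v\<in>tangent_space A p. v \<noteq> 0 \<longrightarrow> g p v v > 0) \<and>
     (\<forall>X Y. vector_field A X \<longrightarrow> vector_field A Y \<longrightarrow> smooth_fun A (\<lambda>p. g p (X p) (Y p)))"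

definition induced_metric :: "('a, 'e::euclidean_space) atlas \<Rightarrow> 'a metric_tensor \<Rightarrow>
    ('b \<Rightarrow> 'a) \<Rightarrow> 'b metric_tensor" where
  "induced_metric A g \<iota> = (\<lambda>q v w. g (\<iota> q) (pushforward A \<iota> v) (pushforward A \<iota> w))"

definition affine_connection ::
    "('a, 'e::euclidean_space) atlas \<Rightarrow> 'a connection \<Rightarrow> bool" where
  "affine_connection A D \<longleftrightarrow>
     (\<forall>X Y. vector_field A X \<longrightarrow> vector_field A Y \<longrightarrow> vector_field A (D X Y)) \<and>
     (\<forall>X X' Y. vector_field A X \<longrightarrow> vector_field A X' \<longrightarrow> vector_field A Y \<longrightarrow>
        D (X + X') Y = D X Y + D X' Y) \<and>
     (\<forall>X Y Y'. vector_field A X \<longrightarrow> vector_field A Y \<longrightarrow> vector_field A Y' \<longrightarrow>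
        D X (Y + Y') = D X Y + D X Y') \<and>
     (\<forall>f X Y. smooth_fun A f \<longrightarrow> vector_field A X \<longrightarrow> vector_field A Y \<longrightarrow>
        D (\<lambda>p. f p *\<^sub>R X p) Y = (\<lambda>p. f p *\<^sub>R D X Y p)) \<and>
     (\<forall>f X Y. smooth_fun A f \<longrightarrow> vector_field A X \<longrightarrow> vector_field A Y \<longrightarrow>
        D X (\<lambda>p. f p *\<^sub>R Y p) = (\<lambda>p. X p f *\<^sub>R Y p + f p *\<^sub>R D X Y p))"

text \<open>Unique on vector fields for a given metric; values of \<open>D\<close> on arguments that are not
  vector fields are irrelevant.\<close>

definition levi_civita ::
    "('a, 'e::euclidean_space) atlas \<Rightarrow> 'a metric_tensor \<Rightarrow> 'a connection \<Rightarrow> bool" where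
  "levi_civita A g D \<longleftrightarrow> affine_connection A D \<and>
     (\<forall>X Y. vector_field A X \<longrightarrow> vector_field A Y \<longrightarrow> D X Y - D Y X = lie_bracket X Y) \<and>
     (\<forall>X Y Z p. vector_field A X \<longrightarrow> vector_field A Y \<longrightarrow> vector_field A Z \<longrightarrow>
        X p (\<lambda>q. g q (Y q) (Z q)) = g p (D X Y p) (Z p) + g p (Y p) (D X Z p))"

definition curvature :: "'a connection \<Rightarrow> 'a vfield \<Rightarrow> 'a vfield \<Rightarrow> 'a vfield \<Rightarrow> 'a vfield" where
  "curvature D X Y Z = D X (D Y Z) - D Y (D X Z) - D (lie_bracket X Y) Z"

definition some_basis :: "'v::real_vector set \<Rightarrow> 'v set" where
  "some_basis V = (SOME B. B \<subseteq> V \<and> independent B \<and> span B = V)"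

definition trace_on :: "'v::real_vector set \<Rightarrow> ('v \<Rightarrow> 'v) \<Rightarrow> real" where
  "trace_on V L = (\<Sum>b\<in>some_basis V. representation (some_basis V) (L b) b)"

definition extension :: "('a, 'e::euclidean_space) atlas \<Rightarrow> 'a \<Rightarrow> 'a tangent \<Rightarrow> 'a vfield" where
  "extension A p v = (SOME X. vector_field A X \<and> X p = v)"

text \<open>\<open>S(Y,Z)\<close> is the trace of \<open>x \<mapsto> R(x,Y)Z\<close>. Since \<open>R(X,Y)Z\<close> at \<open>p\<close> depends on \<open>X\<close> only
  through \<open>X p\<close>, the choice of the extension of \<open>x\<close> to a vector field is immaterial.\<close>

definition ricci :: "('a, 'e::euclidean_space) atlas \<Rightarrow> 'a connection \<Rightarrow>
    'a vfield \<Rightarrow> 'a vfield \<Rightarrow> 'a \<Rightarrow> real" where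
  "ricci A D Y Z p =
     trace_on (tangent_space A p) (\<lambda>x. curvature D (extension A p x) Y Z p)"

definition lie_derivative_metric ::
    "'a vfield \<Rightarrow> 'a metric_tensor \<Rightarrow> 'a vfield \<Rightarrow> 'a vfield \<Rightarrow> 'a \<Rightarrow> real" where
  "lie_derivative_metric V g Y Z p =
     V p (\<lambda>q. g q (Y q) (Z q)) - g p (lie_bracket V Y p) (Z p) - g p (Y p) (lie_bracket V Z p)"

text \<open>In the next two definitions \<open>D\<close> is meant to be the Levi-Civita connection of \<open>g\<close>.\<close>

definition ricci_soliton :: "('a, 'e::euclidean_space) atlas \<Rightarrow> 'a connection \<Rightarrow>
    'a metric_tensor \<Rightarrow> 'a vfield \<Rightarrow> real \<Rightarrow> bool" where
  "ricci_soliton A D g V lam \<longleftrightarrow> vector_field A V \<and>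
     (\<forall>Y Z p. vector_field A Y \<longrightarrow> vector_field A Z \<longrightarrow>
        lie_derivative_metric V g Y Z p + 2 * ricci A D Y Z p + 2 * lam * g p (Y p) (Z p) = 0)"

definition einstein :: "('a, 'e::euclidean_space) atlas \<Rightarrow> 'a connection \<Rightarrow>
    'a metric_tensor \<Rightarrow> bool" where
  "einstein A D g \<longleftrightarrow> (\<exists>c. \<forall>Y Z p. vector_field A Y \<longrightarrow> vector_field A Z \<longrightarrow>
     ricci A D Y Z p = c * g p (Y p) (Z p))"

subsection \<open>Generalized Sasakian-space-forms\<close>

locale almost_contact_metric_manifold =
  fixes A :: "('a::{t2_space, second_countable_topology}, 'e::euclidean_space) atlas"
    and \<phi> :: "'a \<Rightarrow> 'a tangent \<Rightarrow> 'a tangent"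
    and \<xi> :: "'a vfield"
    and \<eta> :: "'a \<Rightarrow> 'a tangent \<Rightarrow> real"
    and g :: "'a metric_tensor"
  assumes atlas: "smooth_atlas A"
    and metric: "riemannian_metric A g"
    and phi_tangent: "v \<in> tangent_space A p \<Longrightarrow> \<phi> p v \<in> tangent_space A p"
    and phi_linear: "linear_on_space (tangent_space A p) (\<phi> p)"
    and phi_smooth: "vector_field A X \<Longrightarrow> vector_field A (\<lambda>p. \<phi> p (X p))"
    and xi_field: "vector_field A \<xi>"
    and eta_linear: "linear_on_space (tangent_space A p) (\<eta> p)"
    and eta_smooth: "vector_field A X \<Longrightarrow> smooth_fun A (\<lambda>p. \<eta> p (X p))"
    and phi_phi: "v \<in> tangent_space A p \<Longrightarrow> \<phi> p (\<phi> p v) = - v + \<eta> p v *\<^sub>R \<xi> p"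
    and phi_xi: "\<phi> p (\<xi> p) = 0"
    and eta_xi: "\<eta> p (\<xi> p) = 1"
    and g_xi: "v \<in> tangent_space A p \<Longrightarrow> g p v (\<xi> p) = \<eta> p v"
    and eta_phi: "v \<in> tangent_space A p \<Longrightarrow> \<eta> p (\<phi> p v) = 0"
    and g_phi_phi: "v \<in> tangent_space A p \<Longrightarrow> w \<in> tangent_space A p \<Longrightarrow>
      g p (\<phi> p v) (\<phi> p w) = g p v w - \<eta> p v * \<eta> p w"

text \<open>The last two assumptions are the structure equations standing throughout.\<close>

locale generalized_sasakian_space_form = almost_contact_metric_manifold A \<phi> \<xi> \<eta> g
  for A :: "('a::{t2_space, second_countable_topology}, 'e::euclidean_space) atlas"
    and \<phi> :: "'a \<Rightarrow> 'a tangent \<Rightarrow> 'a tangent"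
    and \<xi> :: "'a vfield"
    and \<eta> :: "'a \<Rightarrow> 'a tangent \<Rightarrow> real"
    and g :: "'a metric_tensor" +
  fixes D :: "'a connection"
    and n :: nat
    and f1 f2 f3 :: "'a \<Rightarrow> real"
  assumes dim: "DIM('e) = 2 * n + 1" "n > 1"
    and connection: "levi_civita A g D"
    and smooth: "smooth_fun A f1" "smooth_fun A f2" "smooth_fun A f3"
    and curvature_form: "vector_field A X \<Longrightarrow> vector_field A Y \<Longrightarrow> vector_field A Z \<Longrightarrow>
      curvature D X Y Z p =
        f1 p *\<^sub>R (g p (Y p) (Z p) *\<^sub>R X p - g p (X p) (Z p) *\<^sub>R Y p)
      + f2 p *\<^sub>R (g p (X p) (\<phi> p (Z p)) *\<^sub>R \<phi> p (Y p) - g p (Y p) (\<phi> p (Z p)) *\<^sub>R \<phi> p (X p)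
                 + (2 * g p (X p) (\<phi> p (Y p))) *\<^sub>R \<phi> p (Z p))
      + f3 p *\<^sub>R ((\<eta> p (X p) * \<eta> p (Z p)) *\<^sub>R Y p - (\<eta> p (Y p) * \<eta> p (Z p)) *\<^sub>R X p
                 + (g p (X p) (Z p) * \<eta> p (Y p)) *\<^sub>R \<xi> p
                 - (g p (Y p) (Z p) * \<eta> p (X p)) *\<^sub>R \<xi> p)"
    and nabla_phi: "vector_field A X \<Longrightarrow> vector_field A Y \<Longrightarrow>
      D X (\<lambda>q. \<phi> q (Y q)) p - \<phi> p (D X Y p) =
        (f1 p - f3 p) *\<^sub>R (g p (X p) (Y p) *\<^sub>R \<xi> p - \<eta> p (Y p) *\<^sub>R X p)"
    and nabla_xi: "vector_field A X \<Longrightarrow> D X \<xi> p = - ((f1 p - f3 p) *\<^sub>R \<phi> p (X p))"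

subsection \<open>Invariant submanifolds\<close>

text \<open>A submanifold is a manifold \<open>'b\<close> with an immersion \<open>\<iota>\<close> into \<open>'a\<close>; its tangent space at
  \<open>q\<close>, seen in the ambient space, is the image of the differential of \<open>\<iota>\<close>. Embedded and
  injectively immersed submanifolds are special cases.\<close>

definition invariant_submanifold ::
    "('a::topological_space, 'e::euclidean_space) atlas \<Rightarrow> ('a \<Rightarrow> 'a tangent \<Rightarrow> 'a tangent) \<Rightarrow>
     'a vfield \<Rightarrow> ('b::{t2_space, second_countable_topology}, 'd::euclidean_space) atlas \<Rightarrow>
     ('b \<Rightarrow> 'a) \<Rightarrow> bool" where
  "invariant_submanifold A \<phi> \<xi> B \<iota> \<longleftrightarrow> smooth_atlas B \<and> immersion B A \<iota> \<and>
     (\<forall>q. \<xi> (\<iota> q) \<in> pushforward A \<iota> ` tangent_space B q) \<and>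
     (\<forall>q. \<phi> (\<iota> q) ` pushforward A \<iota> ` tangent_space B q \<subseteq> pushforward A \<iota> ` tangent_space B q)"

text \<open>The field on the submanifold corresponding to an ambient field tangent to it.\<close>

definition restricted_field :: "('a, 'e::euclidean_space) atlas \<Rightarrow>
    ('b, 'd::euclidean_space) atlas \<Rightarrow> ('b \<Rightarrow> 'a) \<Rightarrow> 'a vfield \<Rightarrow> 'b vfield" where
  "restricted_field A B \<iota> X =
     (\<lambda>q. the_inv_into (tangent_space B q) (pushforward A \<iota>) (X (\<iota> q)))"

end

theory Submission
  imports Defs
begin

text \<open>
  The soliton equation expresses the Ricci tensor of the submanifold by its metric and the Lie
  derivative of that metric along the restricted Reeb field, so it suffices that this field is
  Killing. In the ambient manifold \<open>\<xi>\<close> is Killing because \<open>\<nabla>\<xi>\<close> is a multiple of the skew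
  endomorphism \<open>\<phi>\<close>, and Killing fields pull back along immersions to which they are tangent. The
  last step is a computation in ambient coordinates. It needs that derivations are spanned by
  coordinate derivations, hence Hadamard's lemma and bump functions.
\<close>

subsection \<open>Calculus of smooth functions\<close>

lemma frechet_derivative_cong_open:
  assumes "open S" "x \<in> S" "\<And>y. y \<in> S \<Longrightarrow> f y = g y"
  shows "frechet_derivative f (at x) = frechet_derivative g (at x)"
proof -
  have "(f has_derivative d) (at x) \<longleftrightarrow> (g has_derivative d) (at x)" for d
    using assms has_derivative_transform_within_open[of f d x UNIV S g]
      has_derivative_transform_within_open[of g d x UNIV S f] by auto
  then show ?thesis
    by (simp add: frechet_derivative_def)
qed

lemma Ck_on_cong:
  assumes "open S" "\<And>x. x \<in> S \<Longrightarrow> f x = g x" "Ck_on k S f"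
  shows "Ck_on k S g"
  using assms(2,3)
proof (induction k arbitrary: f g)
  case 0
  then show ?case by (simp cong: continuous_on_cong)
next
  case (Suc k)
  have "g differentiable (at x)" if x: "x \<in> S" for x
  proof -
    from Suc.prems x obtain d where "(f has_derivative d) (at x)"
      by (auto simp: differentiable_def)
    from has_derivative_transform_within_open[OF this assms(1) x Suc.prems(1)]
    show ?thesis by (rule differentiableI)
  qed
  moreover have "Ck_on k S (\<lambda>x. frechet_derivative g (at x) v)" for v
  proof (rule Suc.IH)
    show "frechet_derivative f (at x) v = frechet_derivative g (at x) v" if "x \<in> S" for x
      by (metis frechet_derivative_cong_open[OF assms(1) that] Suc.prems(1))
    show "Ck_on k S (\<lambda>x. frechet_derivative f (at x) v)"
      using Suc.prems(2) by simp
  qed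
  ultimately show ?case by simp
qed

lemma Ck_on_SucI:
  assumes "open S" "\<And>x. x \<in> S \<Longrightarrow> (f has_derivative f' x) (at x)"
    "\<And>v. Ck_on k S (\<lambda>x. f' x v)"
  shows "Ck_on (Suc k) S f"
proof -
  have "Ck_on k S (\<lambda>x. frechet_derivative f (at x) v)" for v
    by (rule Ck_on_cong[OF assms(1) _ assms(3)[of v]])
      (rule fun_cong[OF frechet_derivative_at[OF assms(2)]])
  then show ?thesis
    using differentiableI[OF assms(2)] by simp
qed

lemma Ck_on_Suc_has_derivative:
  "Ck_on (Suc k) S f \<Longrightarrow> x \<in> S \<Longrightarrow> (f has_derivative frechet_derivative f (at x)) (at x)"
  by (simp add: frechet_derivative_works[symmetric])

lemma Ck_on_subset: "Ck_on k S f \<Longrightarrow> T \<subseteq> S \<Longrightarrow> Ck_on k T f"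
  by (induction k arbitrary: f) (auto intro: continuous_on_subset)

lemma Ck_on_Suc_imp: "Ck_on (Suc k) S f \<Longrightarrow> Ck_on k S f"
  by (induction k arbitrary: f)
    (auto intro!: differentiable_imp_continuous_on
      simp: differentiable_on_def differentiable_at_withinI)

lemma Ck_on_imp_continuous_on: "Ck_on k S f \<Longrightarrow> continuous_on S f"
  by (induction k) (auto dest: Ck_on_Suc_imp simp del: Ck_on.simps(2))

lemma Ck_on_local:
  assumes "\<And>x. x \<in> S \<Longrightarrow> \<exists>T. open T \<and> x \<in> T \<and> Ck_on k T f"
  shows "Ck_on k S f"
  using assms
proof (induction k arbitrary: f)
  case 0
  have "isCont f x" if "x \<in> S" for x
    using 0[OF that] by (auto simp: continuous_on_eq_continuous_at)
  then show ?case
    by (simp add: continuous_at_imp_continuous_on)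
next
  case (Suc k)
  have "f differentiable (at x)" if "x \<in> S" for x
    using Suc.prems[OF that] by auto
  moreover have "Ck_on k S (\<lambda>x. frechet_derivative f (at x) v)" for v
    using Suc.prems by (intro Suc.IH) (metis Ck_on.simps(2))
  ultimately show ?case by simp
qed

lemma Ck_on_const: "open S \<Longrightarrow> Ck_on k S (\<lambda>x. c)"
proof (induction k arbitrary: c)
  case (Suc k)
  then show ?case
    by (intro Ck_on_SucI[where f' = "\<lambda>_ _. 0"]) auto
qed auto

lemma Ck_on_bounded_linear_compose:
  assumes "open S" "bounded_linear L" "Ck_on k S f"
  shows "Ck_on k S (\<lambda>x. L (f x))"
  using assms(3)
proof (induction k arbitrary: f)
  case 0
  then show ?case
    using assms(2) by (simp add: bounded_linear.continuous_on)
next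
  case (Suc k)
  note f' = Ck_on_Suc_has_derivative[OF Suc.prems]
  show ?case
    by (rule Ck_on_SucI[OF assms(1) bounded_linear.has_derivative[OF assms(2) f']])
      (use Suc in auto)
qed

lemma Ck_on_bounded_linear:
  assumes "open S" "bounded_linear L"
  shows "Ck_on k S L"
proof (cases k)
  case 0
  then show ?thesis
    using assms by (simp add: linear_continuous_on)
next
  case (Suc m)
  show ?thesis
    unfolding Suc using assms
    by (intro Ck_on_SucI[where f' = "\<lambda>x. L"] bounded_linear_imp_has_derivative Ck_on_const)
qed

lemma Ck_on_add:
  assumes "open S" "Ck_on k S f" "Ck_on k S g"
  shows "Ck_on k S (\<lambda>x. f x + g x)"
  using assms(2,3)
proof (induction k arbitrary: f g)
  case 0
  then show ?case by (simp add: continuous_on_add)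
next
  case (Suc k)
  note f' = Ck_on_Suc_has_derivative[OF Suc.prems(1)]
  note g' = Ck_on_Suc_has_derivative[OF Suc.prems(2)]
  show ?case
    by (rule Ck_on_SucI[OF assms(1) has_derivative_add[OF f' g']]) (use Suc in auto)
qed

lemma Ck_on_mult:
  fixes f g :: "'e::euclidean_space \<Rightarrow> real"
  assumes "open S" "Ck_on k S f" "Ck_on k S g"
  shows "Ck_on k S (\<lambda>x. f x * g x)"
  using assms(2,3)
proof (induction k arbitrary: f g)
  case 0
  then show ?case by (simp add: continuous_on_mult)
next
  case (Suc k)
  note f' = Ck_on_Suc_has_derivative[OF Suc.prems(1)]
  note g' = Ck_on_Suc_has_derivative[OF Suc.prems(2)]
  note fg = Suc.prems[THEN Ck_on_Suc_imp]
  show ?case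
    by (rule Ck_on_SucI[OF assms(1) has_derivative_mult[OF f' g']])
      (use Suc fg in \<open>auto intro!: Ck_on_add[OF assms(1)]\<close>)
qed

lemma Ck_on_sum:
  assumes "open S" "finite I" "\<And>i. i \<in> I \<Longrightarrow> Ck_on k S (f i)"
  shows "Ck_on k S (\<lambda>x. \<Sum>i\<in>I. f i x)"
  using assms(2,3)
  by (induction I) (auto intro: Ck_on_const[OF assms(1)] Ck_on_add[OF assms(1)])

lemma Ck_on_compose:
  fixes f :: "'e::euclidean_space \<Rightarrow> real" and h :: "'d::euclidean_space \<Rightarrow> 'e"
  assumes "open S" "open T" "h ` S \<subseteq> T" "Ck_on k T f" "Ck_on k S h"
  shows "Ck_on k S (\<lambda>x. f (h x))"
  using assms(4,5)
proof (induction k arbitrary: f)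
  case 0
  then show ?case
    using assms(3) by (auto intro: continuous_on_compose2)
next
  case (Suc k)
  let ?f' = "\<lambda>x v. \<Sum>b\<in>Basis. (frechet_derivative h (at x) v \<bullet> b) * frechet_derivative f (at (h x)) b"
  have "((\<lambda>x. f (h x)) has_derivative ?f' x) (at x)" if "x \<in> S" for x
  proof -
    have f: "(f has_derivative frechet_derivative f (at (h x))) (at (h x))"
      using Suc.prems(1) assms(3) that by (intro Ck_on_Suc_has_derivative[of k T f]) auto
    have h: "(h has_derivative frechet_derivative h (at x)) (at x)"
      using Suc.prems(2) that by (rule Ck_on_Suc_has_derivative)
    have "frechet_derivative f (at (h x)) w = (\<Sum>b\<in>Basis. (w \<bullet> b) * frechet_derivative f (at (h x)) b)" for w
      using Linear_Algebra.linear_componentwise[OF has_derivative_linear[OF f], of w 1]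
      by (simp only: inner_real_def mult_1_right)
    then have "frechet_derivative f (at (h x)) \<circ> frechet_derivative h (at x) = ?f' x"
      unfolding o_def by (rule ext)
    with diff_chain_at[OF h f] show ?thesis
      by (simp add: o_def)
  qed
  moreover have "Ck_on k S (\<lambda>x. ?f' x v)" for v
    using Suc.prems Ck_on_Suc_imp[OF Suc.prems(2)]
    by (intro Ck_on_sum[OF assms(1)] Ck_on_mult[OF assms(1)] Suc.IH
        Ck_on_bounded_linear_compose[OF assms(1), of "\<lambda>x. x \<bullet> _"] bounded_linear_inner_left) auto
  ultimately show ?case
    by (rule Ck_on_SucI[OF assms(1)])
qed

lemma smooth_on_cong:
  "open S \<Longrightarrow> (\<And>x. x \<in> S \<Longrightarrow> f x = g x) \<Longrightarrow> smooth_on S f \<Longrightarrow> smooth_on S g"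
  unfolding smooth_on_def using Ck_on_cong by blast

lemma smooth_on_subset: "smooth_on S f \<Longrightarrow> T \<subseteq> S \<Longrightarrow> smooth_on T f"
  unfolding smooth_on_def using Ck_on_subset by blast

lemma smooth_on_local:
  "(\<And>x. x \<in> S \<Longrightarrow> \<exists>T. open T \<and> x \<in> T \<and> smooth_on T f) \<Longrightarrow> smooth_on S f"
  unfolding smooth_on_def by (meson Ck_on_local)

lemma smooth_on_compose:
  fixes f :: "'e::euclidean_space \<Rightarrow> real" and h :: "'d::euclidean_space \<Rightarrow> 'e"
  shows "open S \<Longrightarrow> open T \<Longrightarrow> h ` S \<subseteq> T \<Longrightarrow> smooth_on T f \<Longrightarrow> smooth_on S h \<Longrightarrow>
    smooth_on S (\<lambda>x. f (h x))"
  unfolding smooth_on_def using Ck_on_compose by blast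

lemma smooth_on_const: "open S \<Longrightarrow> smooth_on S (\<lambda>x. c)"
  unfolding smooth_on_def using Ck_on_const by blast

lemma smooth_on_bounded_linear: "open S \<Longrightarrow> bounded_linear L \<Longrightarrow> smooth_on S L"
  unfolding smooth_on_def using Ck_on_bounded_linear by blast

lemma smooth_on_add:
  "open S \<Longrightarrow> smooth_on S f \<Longrightarrow> smooth_on S g \<Longrightarrow> smooth_on S (\<lambda>x. f x + g x)"
  unfolding smooth_on_def using Ck_on_add by blast

lemma smooth_on_mult:
  fixes f g :: "'e::euclidean_space \<Rightarrow> real"
  shows "open S \<Longrightarrow> smooth_on S f \<Longrightarrow> smooth_on S g \<Longrightarrow> smooth_on S (\<lambda>x. f x * g x)"
  unfolding smooth_on_def using Ck_on_mult by blast

lemma smooth_on_imp_has_derivative: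
  "smooth_on S f \<Longrightarrow> x \<in> S \<Longrightarrow> (f has_derivative frechet_derivative f (at x)) (at x)"
  unfolding smooth_on_def using Ck_on_Suc_has_derivative by blast

lemma smooth_on_frechet_derivative:
  "smooth_on S f \<Longrightarrow> smooth_on S (\<lambda>x. frechet_derivative f (at x) v)"
  unfolding smooth_on_def by (metis Ck_on.simps(2))

subsection \<open>Bump functions\<close>

definition flat :: "nat \<Rightarrow> real \<Rightarrow> real" where
  "flat n x = (if x > 0 then exp (- 1 / x) / x ^ n else 0)"

lemma flat_has_real_derivative:
  "(flat n has_real_derivative (flat (n + 2) x - real n * flat (n + 1) x)) (at x)"
proof -
  consider "x > 0" | "x < 0" | "x = 0" by linarith
  then show ?thesis
  proof cases
    case 1
    have "((\<lambda>x. exp (- 1 / x) / x ^ n) has_real_derivative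
        (flat (n + 2) x - real n * flat (n + 1) x)) (at x)"
      using 1
      apply (auto intro!: derivative_eq_intros simp: flat_def power2_eq_square)
      apply (cases n; simp add: field_simps)
      done
    then show ?thesis
      by (rule DERIV_cong_ev[THEN iffD1, rotated -1])
        (use 1 eventually_gt_at_top in \<open>auto simp: flat_def intro!: eventually_mono[OF eventually_nhds_in_open[of "{0<..}"]]\<close>)
  next
    case 2
    have "((\<lambda>x. 0) has_real_derivative (flat (n + 2) x - real n * flat (n + 1) x)) (at x)"
      using 2 by (auto simp: flat_def)
    then show ?thesis
      by (rule DERIV_cong_ev[THEN iffD1, rotated -1])
        (use 2 in \<open>auto simp: flat_def intro!: eventually_mono[OF eventually_nhds_in_open[of "{..<0}"]]\<close>)
  next
    case 3
    have "((\<lambda>h. inverse h ^ Suc n / exp (inverse h)) \<longlongrightarrow> 0) (at_right (0::real))"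
      by (rule filterlim_compose[OF tendsto_power_div_exp_0 filterlim_inverse_at_top_right])
    then have "((\<lambda>h. flat n h / h) \<longlongrightarrow> 0) (at_right 0)"
      by (rule Lim_transform_eventually)
        (auto simp: flat_def eventually_at_filter exp_minus field_simps)
    moreover have "((\<lambda>h. flat n h / h) \<longlongrightarrow> 0) (at_left 0)"
      by (rule Lim_transform_eventually[OF tendsto_const]) (auto simp: flat_def eventually_at_filter)
    ultimately have "((\<lambda>h. flat n h / h) \<longlongrightarrow> 0) (at 0)"
      by (simp add: filterlim_split_at)
    then show ?thesis
      using 3 by (simp add: DERIV_def flat_def)
  qed
qed

lemma Ck_on_flat: "Ck_on k UNIV (flat n)"
proof (induction k arbitrary: n)
  case 0
  then show ?case
    using flat_has_real_derivative by (auto intro!: continuous_at_imp_continuous_on DERIV_isCont)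
next
  case (Suc k)
  show ?case
    using flat_has_real_derivative[of n, unfolded has_field_derivative_def]
    by (rule Ck_on_SucI[OF open_UNIV])
      (use Ck_on_add[OF open_UNIV Suc Ck_on_mult[OF open_UNIV Ck_on_const[OF open_UNIV] Suc],
        of "n + 2" "- real n" "n + 1"] in \<open>auto intro!: Ck_on_mult Ck_on_const\<close>)
qed

text \<open>The value is \<open>0\<close> where \<open>flat 0 (1 - x) \<ge> flat 0 1\<close> and constant where \<open>flat 0 (1 - x) = 0\<close>;
  nesting \<open>flat\<close> avoids division by a non-constant function.\<close>

definition smooth_step :: "real \<Rightarrow> real" where
  "smooth_step x = flat 0 (flat 0 1 - flat 0 (1 - x)) / flat 0 (flat 0 1)"

lemma smooth_step_eq_0: "x \<le> 0 \<Longrightarrow> smooth_step x = 0"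
  by (simp add: smooth_step_def flat_def field_simps)

lemma smooth_step_eq_1: "x \<ge> 1 \<Longrightarrow> smooth_step x = 1"
  by (simp add: smooth_step_def flat_def)

lemma smooth_on_smooth_step: "smooth_on UNIV smooth_step"
proof -
  have flat: "smooth_on UNIV (flat n)" for n
    by (simp add: smooth_on_def Ck_on_flat)
  have affine: "smooth_on UNIV (\<lambda>x::real. a + b * x)" for a b
    by (intro smooth_on_add smooth_on_const smooth_on_bounded_linear bounded_linear_mult_right) auto
  have "smooth_on UNIV (\<lambda>x. flat 0 (1 + (- 1) * x))"
    by (intro smooth_on_compose[OF _ _ _ flat affine]) auto
  then have "smooth_on UNIV (\<lambda>x. flat 0 1 + (- 1) * flat 0 (1 + (- 1) * x))"
    by (intro smooth_on_add smooth_on_mult smooth_on_const) auto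
  then have "smooth_on UNIV (\<lambda>x. inverse (flat 0 (flat 0 1)) * flat 0 (flat 0 1 + (- 1) * flat 0 (1 + (- 1) * x)))"
    by (intro smooth_on_mult smooth_on_const smooth_on_compose[OF _ _ _ flat]) auto
  then show ?thesis
    by (simp add: smooth_step_def[abs_def] divide_inverse mult.commute)
qed

lemma bump_function:
  fixes a :: "'e::euclidean_space"
  assumes "e > 0"
  obtains \<psi> :: "'e \<Rightarrow> real" and d where "smooth_on UNIV \<psi>" "d > 0" "d < e"
    "\<And>x. x \<in> ball a d \<Longrightarrow> \<psi> x = 1" "\<And>x. x \<notin> cball a e \<Longrightarrow> \<psi> x = 0"
proof -
  let ?u = "\<lambda>x. 2 + (- 2 / e\<^sup>2) * ((x - a) \<bullet> (x - a))"
  have lin: "smooth_on UNIV (\<lambda>x::'e. 2 * ((x - a) \<bullet> v))" for v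
  proof -
    have "smooth_on UNIV (\<lambda>x::'e. (- 2 * (a \<bullet> v)) + 2 * (x \<bullet> v))"
      by (intro smooth_on_add smooth_on_mult smooth_on_const smooth_on_bounded_linear
          bounded_linear_inner_left) auto
    then show ?thesis
      by (simp add: algebra_simps)
  qed
  have sq: "smooth_on UNIV (\<lambda>x::'e. (x - a) \<bullet> (x - a))"
    unfolding smooth_on_def
  proof
    fix k
    show "Ck_on k UNIV (\<lambda>x::'e. (x - a) \<bullet> (x - a))"
    proof (cases k)
      case 0
      then show ?thesis by (auto intro!: continuous_intros)
    next
      case (Suc m)
      show ?thesis
        unfolding Suc
        by (rule Ck_on_SucI[where f' = "\<lambda>x v. 2 * ((x - a) \<bullet> v)"])
          (use lin in \<open>auto intro!: derivative_eq_intros simp: inner_commute smooth_on_def\<close>)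
    qed
  qed
  have "smooth_on UNIV ?u"
    by (intro smooth_on_add smooth_on_mult smooth_on_const sq) auto
  then have smooth: "smooth_on UNIV (\<lambda>x. smooth_step (?u x))"
    by (intro smooth_on_compose[OF _ _ _ smooth_on_smooth_step]) auto
  have one: "smooth_step (?u x) = 1" if "x \<in> ball a (e / 2)" for x
  proof -
    have "(norm (x - a))\<^sup>2 \<le> (e / 2)\<^sup>2"
      using that by (intro power_mono) (auto simp: dist_norm norm_minus_commute)
    then have "4 * ((x - a) \<bullet> (x - a)) \<le> e\<^sup>2"
      by (simp add: power2_norm_eq_inner power_divide)
    with inner_ge_zero[of "x - a"] have "2 * ((x - a) \<bullet> (x - a)) \<le> e\<^sup>2"
      by linarith
    then show ?thesis
      using assms by (intro smooth_step_eq_1) (simp add: field_simps)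
  qed
  have zero: "smooth_step (?u x) = 0" if "x \<notin> cball a e" for x
  proof -
    have "e\<^sup>2 \<le> (norm (x - a))\<^sup>2"
      using that assms by (intro power_mono) (auto simp: dist_norm norm_minus_commute)
    then show ?thesis
      using assms by (intro smooth_step_eq_0) (simp add: power2_norm_eq_inner field_simps)
  qed
  show ?thesis
    by (rule that[of "\<lambda>x. smooth_step (?u x)" "e / 2"]) (use smooth one zero assms in auto)
qed

subsection \<open>Hadamard's lemma\<close>

lemma Ck_on_integral_segment:
  fixes F :: "'e::euclidean_space \<Rightarrow> real"
  assumes "Ck_on k (ball a e) F"
  shows "Ck_on k (ball a e) (\<lambda>x. integral {0..1} (\<lambda>t. t ^ m * F (a + t *\<^sub>R (x - a))))"
  using assms
proof (induction k arbitrary: F m)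
  have seg: "a + t *\<^sub>R (x - a) \<in> ball a e" if "x \<in> ball a e" "t \<in> cbox 0 1" for x and t :: real
  proof -
    have "t * norm (x - a) \<le> 1 * norm (x - a)"
      using that by (intro mult_right_mono) auto
    then show ?thesis
      using that by (simp add: dist_norm norm_minus_commute)
  qed
  have cont: "continuous_on (ball a e \<times> cbox 0 1) (\<lambda>(x, t). t ^ m * F (a + t *\<^sub>R (x - a)))"
    if "continuous_on (ball a e) F" for F :: "'e \<Rightarrow> real" and m
    unfolding case_prod_unfold using seg
    by (intro continuous_intros continuous_on_compose2[OF that]) auto
  {
    case 0
    then show ?case
      using integral_continuous_on_param[OF cont[of F m]] by simp
  next
    case (Suc k)
    define fx where "fx x t = Blinfun (\<lambda>v. t ^ Suc m * frechet_derivative F (at (a + t *\<^sub>R (x - a))) v)"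
      for x :: 'e and t :: real
    have F': "(F has_derivative frechet_derivative F (at y)) (at y)" if "y \<in> ball a e" for y
      using Suc.prems that by (rule Ck_on_Suc_has_derivative)
    have fx: "blinfun_apply (fx x t) = (\<lambda>v. t ^ Suc m * frechet_derivative F (at (a + t *\<^sub>R (x - a))) v)"
      if "x \<in> ball a e" "t \<in> cbox 0 1" for x t
      unfolding fx_def
      by (intro bounded_linear_Blinfun_apply bounded_linear_const_mult has_derivative_bounded_linear[OF F'] seg that)
    have "continuous_on (ball a e \<times> cbox 0 1) (\<lambda>(x, t). blinfun_apply (fx x t) v)" for v
    proof -
      have "continuous_on (ball a e) (\<lambda>y. frechet_derivative F (at y) v)"
        using Suc.prems by (intro Ck_on_imp_continuous_on[of k]) simp
      from cont[OF this, of "Suc m"] show ?thesis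
        by (rule continuous_on_eq) (auto simp: fx simp del: mem_box cbox_interval mem_ball)
    qed
    note fx_v = this
    have fx_cont: "continuous_on (ball a e \<times> cbox 0 1) (\<lambda>(x, t). fx x t)"
      using fx_v by (intro continuous_on_blinfun_componentwise) (simp add: case_prod_unfold)
    have der: "((\<lambda>x. integral (cbox 0 1) (\<lambda>t. t ^ m * F (a + t *\<^sub>R (x - a)))) has_derivative
        integral (cbox 0 1) (fx x)) (at x)" if x: "x \<in> ball a e" for x
    proof -
      have "((\<lambda>x. t ^ m * F (a + t *\<^sub>R (x - a))) has_derivative blinfun_apply (fx x t)) (at x within ball a e)"
        if "x \<in> ball a e" "t \<in> cbox 0 1" for x t
      proof -
        have "((\<lambda>x. a + t *\<^sub>R (x - a)) has_derivative (\<lambda>v. t *\<^sub>R v)) (at x)"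
          by (auto intro!: derivative_eq_intros)
        from has_derivative_mult_right[OF diff_chain_at[OF this F'[OF seg[OF that]]], of "t ^ m"]
        have "((\<lambda>x. t ^ m * F (a + t *\<^sub>R (x - a))) has_derivative
            (\<lambda>v. t ^ m * frechet_derivative F (at (a + t *\<^sub>R (x - a))) (t *\<^sub>R v))) (at x)"
          by (simp add: o_def)
        moreover have "frechet_derivative F (at (a + t *\<^sub>R (x - a))) (t *\<^sub>R v) =
            t * frechet_derivative F (at (a + t *\<^sub>R (x - a))) v" for v
          using has_derivative_linear[OF F'[OF seg[OF that]]] by (simp add: linear_cmul)
        ultimately show ?thesis
          unfolding fx[OF that] by (auto simp: mult_ac intro: has_derivative_at_withinI)
      qed
      moreover have "(\<lambda>t. t ^ m * F (a + t *\<^sub>R (x - a))) integrable_on cbox 0 1" if "x \<in> ball a e" for x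
      proof -
        have "continuous_on (ball a e) F"
          using Suc.prems by (rule Ck_on_imp_continuous_on)
        have "continuous_on (cbox 0 1) (\<lambda>t. case (x, t) of (x, t) \<Rightarrow> t ^ m * F (a + t *\<^sub>R (x - a)))"
          by (rule continuous_on_compose2[OF cont[OF \<open>continuous_on (ball a e) F\<close>, of m]])
            (use that in \<open>auto intro!: continuous_intros\<close>)
        then show ?thesis
          by (intro integrable_continuous) simp
      qed
      ultimately have "((\<lambda>x. integral (cbox 0 1) (\<lambda>t. t ^ m * F (a + t *\<^sub>R (x - a)))) has_derivative
        integral (cbox 0 1) (fx x)) (at x within ball a e)"
        using fx_cont x by (intro leibniz_rule) auto
      then show ?thesis
        by (simp only: at_within_open[OF x open_ball])
    qed
    have eq: "integral (cbox 0 1) (fx x) v =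
        integral {0..1} (\<lambda>t. t ^ Suc m * frechet_derivative F (at (a + t *\<^sub>R (x - a))) v)"
      if x: "x \<in> ball a e" for x v
    proof -
      have "fx x integrable_on cbox 0 1"
      proof -
        have "continuous_on (cbox 0 1) (\<lambda>t. case (x, t) of (x, t) \<Rightarrow> fx x t)"
          by (rule continuous_on_compose2[OF fx_cont]) (use x in \<open>auto intro!: continuous_intros\<close>)
        then show ?thesis
          by (intro integrable_continuous) simp
      qed
      from integral_linear[OF this blinfun.bounded_linear_left, of v]
      have "integral (cbox 0 1) (fx x) v = integral (cbox 0 1) (\<lambda>t. fx x t v)"
        by (simp add: o_def)
      also have "\<dots> = integral (cbox 0 1) (\<lambda>t. t ^ Suc m * frechet_derivative F (at (a + t *\<^sub>R (x - a))) v)"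
        using fx[OF x] by (intro integral_cong) simp
      finally show ?thesis by simp
    qed
    have "Ck_on k (ball a e) (\<lambda>x. integral (cbox 0 1) (fx x) v)" for v
      using Suc.prems
      by (intro Ck_on_cong[OF open_ball eq[symmetric] Suc.IH]) auto
    with der show ?case
      by (intro Ck_on_SucI[OF open_ball]) auto
  }
qed

lemma Hadamard:
  fixes f :: "'e::euclidean_space \<Rightarrow> real"
  assumes "smooth_on (ball a e) f" "e > 0"
  obtains G where "\<And>b. smooth_on (ball a e) (G b)" "\<And>b. G b a = frechet_derivative f (at a) b"
    "\<And>x. x \<in> ball a e \<Longrightarrow> f x = f a + (\<Sum>b\<in>Basis. ((x - a) \<bullet> b) * G b x)"
proof -
  define G where "G b x = integral {0..1} (\<lambda>t. t ^ 0 * frechet_derivative f (at (a + t *\<^sub>R (x - a))) b)" for b x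
  have "smooth_on (ball a e) (G b)" for b
    using smooth_on_frechet_derivative[OF assms(1), of b]
    unfolding smooth_on_def G_def[abs_def] by (intro allI Ck_on_integral_segment) auto
  moreover have "G b a = frechet_derivative f (at a) b" for b
    by (simp add: G_def)
  moreover have "f x = f a + (\<Sum>b\<in>Basis. ((x - a) \<bullet> b) * G b x)" if x: "x \<in> ball a e" for x
  proof -
    let ?p = "\<lambda>t. a + t *\<^sub>R (x - a)"
    have seg: "?p t \<in> ball a e" if "t \<in> {0..1}" for t
    proof -
      have "t * norm (x - a) \<le> 1 * norm (x - a)"
        using that by (intro mult_right_mono) auto
      then show ?thesis
        using that x by (simp add: dist_norm norm_minus_commute)
    qed
    have f': "(f has_derivative frechet_derivative f (at (?p t))) (at (?p t))" if "t \<in> {0..1}" for t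
      using assms(1) seg[OF that] by (rule smooth_on_imp_has_derivative)
    have "((\<lambda>t. frechet_derivative f (at (?p t)) (x - a)) has_integral f (?p 1) - f (?p 0)) {0..1}"
    proof (rule fundamental_theorem_of_calculus)
      fix t :: real
      assume t: "t \<in> {0..1}"
      have "(?p has_derivative (\<lambda>s. s *\<^sub>R (x - a))) (at t)"
        by (auto intro!: derivative_eq_intros)
      from diff_chain_at[OF this f'[OF t]]
      have "((\<lambda>t. f (?p t)) has_derivative (\<lambda>s. frechet_derivative f (at (?p t)) (s *\<^sub>R (x - a)))) (at t)"
        by (simp add: o_def)
      then show "((\<lambda>t. f (?p t)) has_vector_derivative frechet_derivative f (at (?p t)) (x - a)) (at t within {0..1})"
        using has_derivative_linear[OF f'[OF t]]
        by (auto simp: has_vector_derivative_def linear_cmul intro: has_derivative_at_withinI)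
    qed auto
    then have "f x - f a = integral {0..1} (\<lambda>t. frechet_derivative f (at (?p t)) (x - a))"
      by (simp add: integral_unique)
    also have "\<dots> = integral {0..1} (\<lambda>t. \<Sum>b\<in>Basis. ((x - a) \<bullet> b) * frechet_derivative f (at (?p t)) b)"
      using Linear_Algebra.linear_componentwise[OF has_derivative_linear[OF f'], of _ "x - a" 1]
      by (intro integral_cong) simp
    also have "\<dots> = (\<Sum>b\<in>Basis. ((x - a) \<bullet> b) * G b x)"
    proof -
      have "(\<lambda>t. frechet_derivative f (at (?p t)) b) integrable_on {0..1}" for b
      proof -
        have "continuous_on (ball a e) (\<lambda>y. frechet_derivative f (at y) b)"
          using smooth_on_frechet_derivative[OF assms(1), of b]
          unfolding smooth_on_def by (metis Ck_on.simps(1))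
        moreover have "continuous_on {0..1} ?p"
          by (intro continuous_intros)
        ultimately have "continuous_on {0..1} (\<lambda>t. frechet_derivative f (at (?p t)) b)"
          by (rule continuous_on_compose2) (use seg in blast)
        then show ?thesis
          by (rule integrable_continuous_interval)
      qed
      then show ?thesis
        by (subst integral_sum) (auto simp: G_def intro: integrable_on_mult_right)
    qed
    finally show ?thesis by simp
  qed
  ultimately show ?thesis by (rule that)
qed

subsection \<open>Smooth functions on manifolds\<close>

lemma sum_fun_apply: "(\<Sum>i\<in>I. f i) x = (\<Sum>i\<in>I. f i x)" for f :: "'i \<Rightarrow> 'x \<Rightarrow> 'y::comm_monoid_add"
  by (induction I rule: infinite_finite_induct) auto

locale smooth_manifold =
  fixes A :: "('a::{t2_space, second_countable_topology}, 'e::euclidean_space) atlas"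
  assumes atlas: "smooth_atlas A"
begin

lemma open_chart: "(U, c) \<in> A \<Longrightarrow> open U"
  and open_chart_range: "(U, c) \<in> A \<Longrightarrow> open (c ` U)"
  using atlas by (auto simp: smooth_atlas_def)

lemma chart_at: obtains U c where "(U, c) \<in> A" "p \<in> U"
proof -
  have "p \<in> (\<Union>(U, c)\<in>A. U)"
    using atlas by (simp add: smooth_atlas_def)
  then show ?thesis using that by auto
qed

lemma chart_homeomorphism:
  assumes "(U, c) \<in> A"
  shows "homeomorphism U (c ` U) c (inv_into U c)"
proof -
  obtain d where d: "homeomorphism U (c ` U) c d"
    using assms atlas by (fastforce simp: smooth_atlas_def)
  then have inj: "inj_on c U"
    by (metis homeomorphism_apply1 inj_onI)
  have "inv_into U c y = d y" if "y \<in> c ` U" for y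
    using that inj d by (auto simp: homeomorphism_apply1[OF d])
  then show ?thesis
    by (intro homeomorphism_cong[OF d]) auto
qed

lemma inv_into_chart: "(U, c) \<in> A \<Longrightarrow> x \<in> U \<Longrightarrow> inv_into U c (c x) = x"
  using homeomorphism_apply1[OF chart_homeomorphism] .

lemma inj_on_chart: "(U, c) \<in> A \<Longrightarrow> inj_on c U"
  by (metis inj_onI inv_into_chart)

lemma open_chart_image:
  assumes "(U, c) \<in> A" "open W" "W \<subseteq> U"
  shows "open (c ` W)"
proof -
  have "openin (top_of_set U) W"
    using assms(2,3) by (simp add: open_subset)
  from homeomorphism_imp_open_map[OF chart_homeomorphism[OF assms(1)] this]
  show ?thesis
    using open_chart_range[OF assms(1)] by (simp add: openin_open_eq)
qed

lemma open_chart_vimage: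
  assumes "(U, c) \<in> A" "open S"
  shows "open (U \<inter> c -` S)"
  using continuous_open_preimage[OF _ open_chart[OF assms(1)] assms(2)]
    chart_homeomorphism[OF assms(1)] by (auto simp: homeomorphism_def)

lemma smooth_transition:
  "(U, c) \<in> A \<Longrightarrow> (V, d) \<in> A \<Longrightarrow> smooth_on (c ` (U \<inter> V)) (d \<circ> inv_into U c)"
  using atlas by (fastforce simp: smooth_atlas_def)

lemma smooth_fun_chart: "smooth_fun A f \<Longrightarrow> (U, c) \<in> A \<Longrightarrow> smooth_on (c ` U) (f \<circ> inv_into U c)"
  by (auto simp: smooth_fun_def)

lemma smooth_fun_const: "smooth_fun A (\<lambda>x. a)"
  by (auto simp: smooth_fun_def o_def intro!: smooth_on_const open_chart_range)

lemma smooth_fun_add: "smooth_fun A f \<Longrightarrow> smooth_fun A h \<Longrightarrow> smooth_fun A (\<lambda>x. f x + h x)"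
  by (auto simp: smooth_fun_def o_def intro!: smooth_on_add open_chart_range)

lemma smooth_fun_mult: "smooth_fun A f \<Longrightarrow> smooth_fun A h \<Longrightarrow> smooth_fun A (\<lambda>x. f x * h x)"
  by (auto simp: smooth_fun_def o_def intro!: smooth_on_mult open_chart_range)

lemma smooth_fun_sum:
  "finite I \<Longrightarrow> (\<And>i. i \<in> I \<Longrightarrow> smooth_fun A (f i)) \<Longrightarrow> smooth_fun A (\<lambda>x. \<Sum>i\<in>I. f i x)"
  by (induction I rule: finite_induct) (auto intro: smooth_fun_const smooth_fun_add)

lemma smooth_funI:
  assumes "\<And>V d y. (V, d) \<in> A \<Longrightarrow> y \<in> V \<Longrightarrow>
    \<exists>W. open W \<and> y \<in> W \<and> W \<subseteq> V \<and> smooth_on (d ` W) (f \<circ> inv_into V d)"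
  shows "smooth_fun A f"
  unfolding smooth_fun_def
proof safe
  fix V d
  assume V: "(V, d) \<in> A"
  show "smooth_on (d ` V) (f \<circ> inv_into V d)"
  proof (rule smooth_on_local)
    fix z
    assume "z \<in> d ` V"
    then obtain y where "y \<in> V" "z = d y" by auto
    with assms[OF V] open_chart_image[OF V]
    show "\<exists>T. open T \<and> z \<in> T \<and> smooth_on T (f \<circ> inv_into V d)"
      by (metis image_eqI)
  qed
qed

lemma smooth_fun_local:
  assumes "\<And>q. \<exists>W F. open W \<and> q \<in> W \<and> smooth_fun A F \<and> (\<forall>x\<in>W. f x = F x)"
  shows "smooth_fun A f"
proof (rule smooth_funI)
  fix V d y
  assume V: "(V, d) \<in> A" and "y \<in> V"
  obtain W F where W: "open W" "y \<in> W" and F: "smooth_fun A F" "\<And>x. x \<in> W \<Longrightarrow> f x = F x"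
    using assms by metis
  have W': "open (V \<inter> W)" "V \<inter> W \<subseteq> V"
    using open_chart[OF V] W by auto
  have "smooth_on (d ` (V \<inter> W)) (F \<circ> inv_into V d)"
    using smooth_fun_chart[OF F(1) V] by (rule smooth_on_subset) auto
  then have "smooth_on (d ` (V \<inter> W)) (f \<circ> inv_into V d)"
    by (rule smooth_on_cong[rotated -1])
      (auto simp: inv_into_chart[OF V] F intro!: open_chart_image[OF V W'])
  then show "\<exists>W. open W \<and> y \<in> W \<and> W \<subseteq> V \<and> smooth_on (d ` W) (f \<circ> inv_into V d)"
    using W W' \<open>y \<in> V\<close> by (metis IntI)
qed

lemma cutoff:
  assumes U: "(U, c) \<in> A" and S: "open S" "S \<subseteq> c ` U" and p: "p \<in> U" "c p \<in> S"
  obtains N \<beta> where "open N" "p \<in> N" "N \<subseteq> U \<inter> c -` S" "\<And>x. x \<in> N \<Longrightarrow> \<beta> x = (1 :: real)"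
    "\<And>x. x \<notin> U \<inter> c -` S \<Longrightarrow> \<beta> x = 0"
    "\<And>u. smooth_on S u \<Longrightarrow> smooth_fun A (\<lambda>x. \<beta> x * u (c x))"
proof -
  obtain e where e: "e > 0" "cball (c p) e \<subseteq> S"
    using S p open_contains_cball by blast
  obtain \<psi> :: "'e \<Rightarrow> real" and d where \<psi>: "smooth_on UNIV \<psi>" and d: "d > 0" "d < e"
    and one: "\<And>x. x \<in> ball (c p) d \<Longrightarrow> \<psi> x = 1" and zero: "\<And>x. x \<notin> cball (c p) e \<Longrightarrow> \<psi> x = 0"
    by (rule bump_function[OF e(1), of "c p"]) (rule that)
  let ?W = "U \<inter> c -` S" and ?N = "U \<inter> c -` ball (c p) d"
  define \<beta> where "\<beta> x = (if x \<in> ?W then \<psi> (c x) else 0)" for x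
  define K where "K = inv_into U c ` cball (c p) e"
  have "compact K"
    unfolding K_def
  proof (rule compact_continuous_image)
    show "continuous_on (cball (c p) e) (inv_into U c)"
      using chart_homeomorphism[OF U] e(2) S(2)
      by (meson continuous_on_subset homeomorphism_def order_trans)
  qed simp
  then have "closed K" by (rule compact_imp_closed)
  have \<beta>_K: "\<beta> x = 0" if "x \<notin> K" for x
  proof (cases "x \<in> ?W")
    case True
    then have "c x \<notin> cball (c p) e"
      using that inv_into_chart[OF U, of x] unfolding K_def by (metis IntD1 imageI)
    then show ?thesis by (simp add: \<beta>_def zero)
  qed (simp only: \<beta>_def if_False)
  have "smooth_fun A (\<lambda>x. \<beta> x * u (c x))" if u: "smooth_on S u" for u
  proof (rule smooth_funI)
    fix V h y
    assume V: "(V, h) \<in> A" and y: "y \<in> V"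
    let ?f = "(\<lambda>x. \<beta> x * u (c x)) \<circ> inv_into V h"
    show "\<exists>W. open W \<and> y \<in> W \<and> W \<subseteq> V \<and> smooth_on (h ` W) ?f"
    proof (cases "y \<in> ?W")
      case True
      let ?T = "V \<inter> ?W"
      have T: "open ?T"
        using open_chart[OF V] open_chart_vimage[OF U S(1)] by blast
      have hT: "open (h ` ?T)"
        using open_chart_image[OF V T] by auto
      have "smooth_on (h ` ?T) (c \<circ> inv_into V h)"
        using smooth_transition[OF V U] by (rule smooth_on_subset) auto
      moreover have "smooth_on S (\<lambda>z. \<psi> z * u z)"
        using \<psi> u S(1) by (intro smooth_on_mult) (auto intro: smooth_on_subset)
      moreover have "(c \<circ> inv_into V h) ` h ` ?T \<subseteq> S"
        by (auto simp: inv_into_chart[OF V])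
      ultimately have "smooth_on (h ` ?T)
          (\<lambda>x. \<psi> ((c \<circ> inv_into V h) x) * u ((c \<circ> inv_into V h) x))"
        using smooth_on_compose[OF hT S(1)] by blast
      then have "smooth_on (h ` ?T) ?f"
        by (rule smooth_on_cong[OF hT, rotated]) (auto simp: \<beta>_def inv_into_chart[OF V])
      then show ?thesis
        using T True y by (intro exI[of _ ?T]) auto
    next
      case False
      have "K \<subseteq> ?W"
      proof
        fix x
        assume "x \<in> K"
        then obtain z where z: "z \<in> cball (c p) e" "x = inv_into U c z" by (auto simp: K_def)
        then have "z \<in> S" "z \<in> c ` U" using e(2) S(2) by auto
        then show "x \<in> ?W"
          using z(2) by (auto intro: inv_into_into simp: f_inv_into_f)
      qed
      with False have "y \<notin> K" by blast
      have T: "open (V - K)"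
        using open_chart[OF V] \<open>closed K\<close> by (rule open_Diff)
      have hT: "open (h ` (V - K))"
        using open_chart_image[OF V T] by auto
      have "smooth_on (h ` (V - K)) ?f"
        by (rule smooth_on_cong[OF hT _ smooth_on_const[OF hT, of 0]])
          (auto simp: \<beta>_K inv_into_chart[OF V])
      then show ?thesis
        using T \<open>y \<notin> K\<close> y by (intro exI[of _ "V - K"]) auto
    qed
  qed
  moreover have "open ?N"
    using open_chart_vimage[OF U] by blast
  moreover have "?N \<subseteq> ?W"
  proof -
    have "ball (c p) d \<subseteq> cball (c p) e" using d by auto
    with e(2) show ?thesis by blast
  qed
  moreover have "\<beta> x = 1" if "x \<in> ?N" for x
    using that \<open>?N \<subseteq> ?W\<close> one[of "c x"] by (auto simp: \<beta>_def)
  moreover have "\<beta> x = 0" if "x \<notin> ?W" for x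
    unfolding \<beta>_def using that by (rule if_not_P)
  moreover have "p \<in> ?N" using p d by simp
  ultimately show ?thesis using that by blast
qed

subsection \<open>Tangent vectors\<close>

lemma tangent_nonsmooth: "v \<in> tangent_space A p \<Longrightarrow> \<not> smooth_fun A f \<Longrightarrow> v f = 0"
  and tangent_linear: "v \<in> tangent_space A p \<Longrightarrow> smooth_fun A f \<Longrightarrow> smooth_fun A h \<Longrightarrow>
     v (\<lambda>x. a * f x + b * h x) = a * v f + b * v h"
  and tangent_mult: "v \<in> tangent_space A p \<Longrightarrow> smooth_fun A f \<Longrightarrow> smooth_fun A h \<Longrightarrow>
     v (\<lambda>x. f x * h x) = f p * v h + h p * v f"
  by (simp_all add: tangent_space_def)

lemma tangent_add:
  "v \<in> tangent_space A p \<Longrightarrow> smooth_fun A f \<Longrightarrow> smooth_fun A h \<Longrightarrow>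
    v (\<lambda>x. f x + h x) = v f + v h"
  using tangent_linear[of v p f h 1 1] by simp

lemma tangent_const:
  assumes "v \<in> tangent_space A p"
  shows "v (\<lambda>x. a) = 0"
proof -
  have "v (\<lambda>x. 1) = 0"
    using tangent_mult[OF assms smooth_fun_const smooth_fun_const, of 1 1] by simp
  then show ?thesis
    using tangent_linear[OF assms smooth_fun_const smooth_fun_const, of a 1 0 1] by simp
qed

lemma tangent_sum:
  assumes v: "v \<in> tangent_space A p" and "finite I" "\<And>i. i \<in> I \<Longrightarrow> smooth_fun A (f i)"
  shows "v (\<lambda>x. \<Sum>i\<in>I. f i x) = (\<Sum>i\<in>I. v (f i))"
  using assms(2,3)
  by (induction I rule: finite_induct) (auto simp: tangent_const[OF v] tangent_add[OF v] smooth_fun_sum)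

lemma tangent_local:
  assumes v: "v \<in> tangent_space A p" and f: "smooth_fun A f" and h: "smooth_fun A h"
    and W: "open W" "p \<in> W" "\<And>x. x \<in> W \<Longrightarrow> f x = h x"
  shows "v f = v h"
proof -
  obtain U c where U: "(U, c) \<in> A" "p \<in> U" by (rule chart_at)
  let ?S = "c ` (U \<inter> W)"
  have S: "open ?S"
    using open_chart[OF U(1)] W by (intro open_chart_image[OF U(1)]) auto
  have sub: "?S \<subseteq> c ` U" "c p \<in> ?S"
    using U(2) W(2) by auto
  obtain N \<beta> where N: "open N" "p \<in> N" "N \<subseteq> U \<inter> c -` ?S" "\<And>x. x \<in> N \<Longrightarrow> \<beta> x = (1 :: real)"
    and zero: "\<And>x. x \<notin> U \<inter> c -` ?S \<Longrightarrow> \<beta> x = 0"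
    and smooth: "\<And>u. smooth_on ?S u \<Longrightarrow> smooth_fun A (\<lambda>x. \<beta> x * u (c x))"
    by (rule cutoff[OF U(1) S sub(1) U(2) sub(2)]) (rule that)
  have \<beta>: "smooth_fun A \<beta>"
    using smooth[OF smooth_on_const[OF S, of 1]] by simp
  have "U \<inter> c -` ?S \<subseteq> W"
    using inj_on_chart[OF U(1)] by (auto dest: inj_onD)
  then have "\<beta> x * f x = \<beta> x * h x" for x
    using zero[of x] W(3)[of x] by (cases "x \<in> W") auto
  then have "v (\<lambda>x. \<beta> x * f x) = v (\<lambda>x. \<beta> x * h x)"
    by presburger
  then show ?thesis
    using N(4)[OF N(2)] W(3)[OF W(2)] by (simp only: tangent_mult[OF v \<beta> f] tangent_mult[OF v \<beta> h])
qed

lemma tangent_expansion: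
  assumes U: "(U, c) \<in> A" and W: "open W" "p \<in> W" "W \<subseteq> U"
    and h: "\<And>b. smooth_fun A (h b)" "\<And>b x. x \<in> W \<Longrightarrow> h b x = c x \<bullet> b"
    and v: "v \<in> tangent_space A p" and f: "smooth_fun A f"
  shows "v f = (\<Sum>b\<in>Basis. v (h b) * frechet_derivative (f \<circ> inv_into U c) (at (c p)) b)"
proof -
  have p: "p \<in> U" using W by auto
  obtain e where e: "e > 0" "ball (c p) e \<subseteq> c ` U"
    using open_chart_range[OF U] p by (meson imageI open_contains_ball)
  let ?f = "f \<circ> inv_into U c"
  have "smooth_on (ball (c p) e) ?f"
    using smooth_fun_chart[OF f U] e(2) by (rule smooth_on_subset)
  then obtain G where G: "\<And>b. smooth_on (ball (c p) e) (G b)"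
      "\<And>b. G b (c p) = frechet_derivative ?f (at (c p)) b"
      "\<And>x. x \<in> ball (c p) e \<Longrightarrow> ?f x = ?f (c p) + (\<Sum>b\<in>Basis. ((x - c p) \<bullet> b) * G b x)"
    by (rule Hadamard[OF _ e(1)]) (rule that)
  obtain N \<beta> where N: "open N" "p \<in> N" "N \<subseteq> U \<inter> c -` ball (c p) e"
      "\<And>x. x \<in> N \<Longrightarrow> \<beta> x = (1 :: real)" "\<And>x. x \<notin> U \<inter> c -` ball (c p) e \<Longrightarrow> \<beta> x = 0"
    and smooth: "\<And>u. smooth_on (ball (c p) e) u \<Longrightarrow> smooth_fun A (\<lambda>x. \<beta> x * u (c x))"
    by (rule cutoff[OF U open_ball e(2) p centre_in_ball[THEN iffD2, OF e(1)]]) (rule that)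
  define a where "a b = - (c p \<bullet> b)" for b
  let ?G = "\<lambda>b x. \<beta> x * G b (c x)" and ?h = "\<lambda>b x. h b x + a b"
  have sG: "smooth_fun A (?G b)" and sh: "smooth_fun A (?h b)" for b
    by (rule smooth[OF G(1)], rule smooth_fun_add[OF h(1) smooth_fun_const])
  have "v f = v (\<lambda>x. f p + (\<Sum>b\<in>Basis. ?h b x * ?G b x))"
  proof (rule tangent_local[OF v f])
    show "smooth_fun A (\<lambda>x. f p + (\<Sum>b\<in>Basis. ?h b x * ?G b x))"
      by (intro smooth_fun_add smooth_fun_const smooth_fun_sum smooth_fun_mult sh sG) auto
    show "open (W \<inter> N)" "p \<in> W \<inter> N"
      using W N by auto
    show "f x = f p + (\<Sum>b\<in>Basis. ?h b x * ?G b x)" if x: "x \<in> W \<inter> N" for x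
    proof -
      have "x \<in> U" "c x \<in> ball (c p) e" using x N by auto
      then have "f x = f p + (\<Sum>b\<in>Basis. ((c x - c p) \<bullet> b) * G b (c x))"
        using G(3)[of "c x"] p by (simp add: inv_into_chart[OF U])
      also have "\<dots> = f p + (\<Sum>b\<in>Basis. ?h b x * ?G b x)"
        using x N(4) h(2) by (simp add: inner_diff_left a_def)
      finally show ?thesis .
    qed
  qed
  also have "\<dots> = (\<Sum>b\<in>Basis. v (\<lambda>x. ?h b x * ?G b x))"
    by (simp add: tangent_add[OF v smooth_fun_const] tangent_const[OF v] tangent_sum[OF v]
        smooth_fun_sum smooth_fun_mult sh sG)
  also have "\<dots> = (\<Sum>b\<in>Basis. v (h b) * frechet_derivative ?f (at (c p)) b)"
  proof (rule sum.cong[OF refl])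
    fix b
    have "?h b p = 0" "?G b p = frechet_derivative ?f (at (c p)) b"
      using W N by (simp_all add: h(2) a_def G(2))
    moreover have "v (?h b) = v (h b)"
      by (simp only: tangent_add[OF v h(1) smooth_fun_const] tangent_const[OF v] add_0_right)
    ultimately show "v (\<lambda>x. ?h b x * ?G b x) = v (h b) * frechet_derivative ?f (at (c p)) b"
      by (simp only: tangent_mult[OF v sh sG] mult_zero_left add_0_left mult.commute)
  qed
  finally show ?thesis .
qed

lemma tangent_space_zero: "0 \<in> tangent_space A p"
  by (simp add: tangent_space_def)

lemma tangent_space_add: "v \<in> tangent_space A p \<Longrightarrow> w \<in> tangent_space A p \<Longrightarrow> v + w \<in> tangent_space A p"
  by (simp add: tangent_space_def algebra_simps)

lemma tangent_space_scaleR: "v \<in> tangent_space A p \<Longrightarrow> a *\<^sub>R v \<in> tangent_space A p"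
  by (simp add: tangent_space_def algebra_simps)

lemma tangent_space_sum:
  "finite I \<Longrightarrow> (\<And>i. i \<in> I \<Longrightarrow> v i \<in> tangent_space A p) \<Longrightarrow> (\<Sum>i\<in>I. v i) \<in> tangent_space A p"
  by (induction I rule: finite_induct) (auto intro: tangent_space_zero tangent_space_add)

lemma vector_field_tangent: "vector_field A X \<Longrightarrow> X p \<in> tangent_space A p"
  and vector_field_smooth: "vector_field A X \<Longrightarrow> smooth_fun A f \<Longrightarrow> smooth_fun A (\<lambda>p. X p f)"
  by (simp_all add: vector_field_def)

lemma lie_bracket_tangent:
  assumes X: "vector_field A X" and Y: "vector_field A Y"
  shows "lie_bracket X Y p \<in> tangent_space A p"
proof -
  note XT = vector_field_tangent[OF X] and YT = vector_field_tangent[OF Y]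
  note Xs = vector_field_smooth[OF X] and Ys = vector_field_smooth[OF Y]
  show ?thesis
    unfolding tangent_space_def lie_bracket_def
  proof (intro CollectI conjI allI impI)
    fix f
    assume "\<not> smooth_fun A f"
    then show "X p (\<lambda>q. Y q f) - Y p (\<lambda>q. X q f) = 0"
      by (simp add: tangent_nonsmooth[OF XT] tangent_nonsmooth[OF YT] tangent_const[OF XT]
          tangent_const[OF YT])
  next
    fix f h a b
    assume f: "smooth_fun A f" and h: "smooth_fun A h"
    show "X p (\<lambda>q. Y q (\<lambda>x. a * f x + b * h x)) - Y p (\<lambda>q. X q (\<lambda>x. a * f x + b * h x)) =
        a * (X p (\<lambda>q. Y q f) - Y p (\<lambda>q. X q f)) + b * (X p (\<lambda>q. Y q h) - Y p (\<lambda>q. X q h))"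
      using f h by (simp add: tangent_linear[OF XT] tangent_linear[OF YT] Xs Ys algebra_simps)
  next
    fix f h
    assume f: "smooth_fun A f" and h: "smooth_fun A h"
    show "X p (\<lambda>q. Y q (\<lambda>x. f x * h x)) - Y p (\<lambda>q. X q (\<lambda>x. f x * h x)) =
        f p * (X p (\<lambda>q. Y q h) - Y p (\<lambda>q. X q h)) + h p * (X p (\<lambda>q. Y q f) - Y p (\<lambda>q. X q f))"
      using f h by (simp add: tangent_mult[OF XT] tangent_mult[OF YT] tangent_add[OF XT]
          tangent_add[OF YT] smooth_fun_mult Xs Ys algebra_simps)
  qed
qed

text \<open>The \<open>h b\<close> play the role of local coordinates and the \<open>E b\<close> that of the coordinate fields,
  both cut off so as to be defined globally; the index set is \<open>Basis\<close>.\<close>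

definition coordinate_frame ::
    "'a set \<Rightarrow> ('e \<Rightarrow> 'a vfield) \<Rightarrow> ('e \<Rightarrow> 'a \<Rightarrow> real) \<Rightarrow> bool" where
  "coordinate_frame N E h \<longleftrightarrow> open N \<and> (\<forall>b. vector_field A (E b)) \<and> (\<forall>b. smooth_fun A (h b)) \<and>
     (\<forall>x\<in>N. \<forall>b\<in>Basis. \<forall>b'\<in>Basis. E b x (h b') = of_bool (b = b')) \<and>
     (\<forall>x\<in>N. \<forall>v\<in>tangent_space A x. v = (\<Sum>b\<in>Basis. v (h b) *\<^sub>R E b x))"

lemma coordinate_frame_at:
  obtains N E h where "coordinate_frame N E h" "p \<in> N"
proof -
  obtain U c where U: "(U, c) \<in> A" "p \<in> U" by (rule chart_at)
  obtain N \<beta> where N: "open N" "p \<in> N" "N \<subseteq> U \<inter> c -` c ` U" "\<And>x. x \<in> N \<Longrightarrow> \<beta> x = (1 :: real)"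
    and zero: "\<And>x. x \<notin> U \<inter> c -` c ` U \<Longrightarrow> \<beta> x = 0"
    and smooth: "\<And>u. smooth_on (c ` U) u \<Longrightarrow> smooth_fun A (\<lambda>x. \<beta> x * u (c x))"
    by (rule cutoff[OF U(1) open_chart_range[OF U(1)] subset_refl U(2) imageI[OF U(2)]]) (rule that)
  define h where "h b x = \<beta> x * (c x \<bullet> b)" for b x
  define E where "E b x f = (if smooth_fun A f
      then \<beta> x * frechet_derivative (f \<circ> inv_into U c) (at (c x)) b else 0)" for b x f
  have NU: "N \<subseteq> U" using N by auto
  have h: "smooth_fun A (h b)" for b
    unfolding h_def using open_chart_range[OF U(1)]
    by (intro smooth smooth_on_bounded_linear bounded_linear_inner_left)
  have hN: "h b x = c x \<bullet> b" if "x \<in> N" for b x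
    using that N by (simp add: h_def)
  have "vector_field A (E b)" for b
    unfolding vector_field_def
  proof (intro conjI allI impI)
    fix f
    assume f: "smooth_fun A f"
    then have "smooth_on (c ` U) (f \<circ> inv_into U c)"
      using U(1) by (rule smooth_fun_chart)
    from smooth[OF smooth_on_frechet_derivative[OF this]] f
    show "smooth_fun A (\<lambda>p. E b p f)"
      by (simp add: E_def)
  next
    fix x
    show "E b x \<in> tangent_space A x"
    proof (cases "x \<in> U")
      case False
      then have "E b x = 0" using zero by (auto simp: E_def fun_eq_iff)
      then show ?thesis by (simp add: tangent_space_zero)
    next
      case True
      have der: "(f \<circ> inv_into U c has_derivative frechet_derivative (f \<circ> inv_into U c) (at (c x))) (at (c x))"
        if "smooth_fun A f" for f
        using smooth_fun_chart[OF that U(1)] True by (intro smooth_on_imp_has_derivative) auto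
      show ?thesis
        unfolding tangent_space_def
      proof (intro CollectI conjI allI impI)
        fix f
        assume "\<not> smooth_fun A f"
        then show "E b x f = 0" by (simp add: E_def)
      next
        fix f k s t
        assume f: "smooth_fun A f" and k: "smooth_fun A k"
        then have fk: "smooth_fun A (\<lambda>x. s * f x + t * k x)"
          by (intro smooth_fun_add smooth_fun_mult smooth_fun_const)
        have "((\<lambda>x. s * f x + t * k x) \<circ> inv_into U c has_derivative
            (\<lambda>w. s * frechet_derivative (f \<circ> inv_into U c) (at (c x)) w +
                 t * frechet_derivative (k \<circ> inv_into U c) (at (c x)) w)) (at (c x))"
          using has_derivative_add[OF has_derivative_mult_right[OF der[OF f], of s]
              has_derivative_mult_right[OF der[OF k], of t]]
          by (simp add: o_def)
        from frechet_derivative_at[OF this, symmetric] f k fk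
        show "E b x (\<lambda>x. s * f x + t * k x) = s * E b x f + t * E b x k"
          by (simp add: E_def algebra_simps)
      next
        fix f k
        assume f: "smooth_fun A f" and k: "smooth_fun A k"
        then have fk: "smooth_fun A (\<lambda>x. f x * k x)"
          by (rule smooth_fun_mult)
        have "((\<lambda>x. f x * k x) \<circ> inv_into U c has_derivative
            (\<lambda>w. f x * frechet_derivative (k \<circ> inv_into U c) (at (c x)) w +
                 frechet_derivative (f \<circ> inv_into U c) (at (c x)) w * k x)) (at (c x))"
          using has_derivative_mult[OF der[OF f] der[OF k]] True
          by (simp add: o_def inv_into_chart[OF U(1)])
        from frechet_derivative_at[OF this, symmetric] f k fk
        show "E b x (\<lambda>x. f x * k x) = f x * E b x k + k x * E b x f"
          by (simp add: E_def algebra_simps)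
      qed
    qed
  qed
  moreover have "E b x (h b') = of_bool (b = b')" if x: "x \<in> N" and b: "b \<in> Basis" "b' \<in> Basis" for x b b'
  proof -
    have "frechet_derivative (h b' \<circ> inv_into U c) (at (c x)) = frechet_derivative (\<lambda>z. z \<bullet> b') (at (c x))"
    proof (rule frechet_derivative_cong_open)
      show "open (c ` N)" by (rule open_chart_image[OF U(1) N(1) NU])
      show "c x \<in> c ` N" using x by simp
      show "(h b' \<circ> inv_into U c) z = z \<bullet> b'" if "z \<in> c ` N" for z
        using that NU by (auto simp: hN inv_into_chart[OF U(1)] subset_iff)
    qed
    also have "\<dots> = (\<lambda>z. z \<bullet> b')"
      by (rule frechet_derivative_at[symmetric])
        (intro bounded_linear_imp_has_derivative bounded_linear_inner_left)
    finally show ?thesis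
      using h N(4)[OF x] b by (simp add: E_def inner_Basis of_bool_def)
  qed
  moreover have "v = (\<Sum>b\<in>Basis. v (h b) *\<^sub>R E b x)" if x: "x \<in> N" and v: "v \<in> tangent_space A x" for x v
  proof
    fix f
    show "v f = (\<Sum>b\<in>Basis. v (h b) *\<^sub>R E b x) f"
    proof (cases "smooth_fun A f")
      case True
      then show ?thesis
        using tangent_expansion[OF U(1) N(1) x NU h hN v True] N(4)[OF x]
        by (simp add: sum_fun_apply E_def)
    qed (simp add: sum_fun_apply E_def tangent_nonsmooth[OF v])
  qed
  ultimately have "coordinate_frame N E h"
    using N(1) h by (simp add: coordinate_frame_def)
  then show ?thesis using N(2) by (rule that)
qed

end

subsection \<open>Killing fields\<close>

lemma riemannian_metric_sym:
  "riemannian_metric A g \<Longrightarrow> v \<in> tangent_space A p \<Longrightarrow> w \<in> tangent_space A p \<Longrightarrow> g p v w = g p w v"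
  by (simp add: riemannian_metric_def)

lemma riemannian_metric_add:
  "riemannian_metric A g \<Longrightarrow> v \<in> tangent_space A p \<Longrightarrow> w \<in> tangent_space A p \<Longrightarrow>
    w' \<in> tangent_space A p \<Longrightarrow> g p v (w + w') = g p v w + g p v w'"
  by (simp add: riemannian_metric_def linear_on_space_def)

lemma riemannian_metric_scaleR:
  "riemannian_metric A g \<Longrightarrow> v \<in> tangent_space A p \<Longrightarrow> w \<in> tangent_space A p \<Longrightarrow>
    g p v (a *\<^sub>R w) = a * g p v w"
  by (simp add: riemannian_metric_def linear_on_space_def)

lemma riemannian_metric_smooth:
  "riemannian_metric A g \<Longrightarrow> vector_field A X \<Longrightarrow> vector_field A Y \<Longrightarrow>
    smooth_fun A (\<lambda>p. g p (X p) (Y p))"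
  by (simp add: riemannian_metric_def)

context smooth_manifold
begin

lemma riemannian_metric_diff:
  assumes "riemannian_metric A g" "v \<in> tangent_space A p" "w \<in> tangent_space A p"
    "w' \<in> tangent_space A p"
  shows "g p v (w - w') = g p v w - g p v w'"
proof -
  have "w - w' = w + (- 1) *\<^sub>R w'" by simp
  then show ?thesis
    using riemannian_metric_add[OF assms(1-3) tangent_space_scaleR[OF assms(4)], of "- 1"]
      riemannian_metric_scaleR[OF assms(1,2,4), of "- 1"] by simp
qed

lemma riemannian_metric_sum:
  assumes g: "riemannian_metric A g" and v: "v \<in> tangent_space A p"
    and "finite I" "\<And>i. i \<in> I \<Longrightarrow> e i \<in> tangent_space A p"
  shows "g p v (\<Sum>i\<in>I. a i *\<^sub>R e i) = (\<Sum>i\<in>I. a i * g p v (e i))"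
  using assms(3,4)
proof (induction I rule: finite_induct)
  case empty
  then show ?case
    using riemannian_metric_scaleR[where g = g, OF g v tangent_space_zero, of 0]
    by (simp only: sum.empty scaleR_zero_left mult_zero_left)
next
  case (insert i I)
  have e: "e i \<in> tangent_space A p"
    using insert.prems by simp
  have "g p v (\<Sum>i\<in>insert i I. a i *\<^sub>R e i) = g p v (a i *\<^sub>R e i + (\<Sum>i\<in>I. a i *\<^sub>R e i))"
    by (simp only: sum.insert[OF insert.hyps])
  also have "\<dots> = g p v (a i *\<^sub>R e i) + g p v (\<Sum>i\<in>I. a i *\<^sub>R e i)"
    using insert by (intro riemannian_metric_add[where g = g, OF g v] tangent_space_scaleR[OF e]
        tangent_space_sum tangent_space_scaleR) auto
  also have "\<dots> = (\<Sum>i\<in>insert i I. a i * g p v (e i))"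
    by (simp only: riemannian_metric_scaleR[where g = g, OF g v e] sum.insert[OF insert.hyps]
        insert.IH[OF insert.prems[OF insertI2]])
  finally show ?case .
qed

lemma coordinate_frameD:
  assumes "coordinate_frame N E h"
  shows "open N" "vector_field A (E b)" "smooth_fun A (h b)" "E b x \<in> tangent_space A x"
    "x \<in> N \<Longrightarrow> b \<in> Basis \<Longrightarrow> b' \<in> Basis \<Longrightarrow> E b x (h b') = of_bool (b = b')"
    "x \<in> N \<Longrightarrow> v \<in> tangent_space A x \<Longrightarrow> v = (\<Sum>b\<in>Basis. v (h b) *\<^sub>R E b x)"
  using assms by (simp_all add: coordinate_frame_def vector_field_tangent)

lemma coordinate_frame_apply:
  assumes "coordinate_frame N E h" "x \<in> N" "v \<in> tangent_space A x"
  shows "v f = (\<Sum>b\<in>Basis. v (h b) * E b x f)"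
  using arg_cong[OF coordinate_frameD(6)[OF assms], of "\<lambda>v. v f"] by (simp add: sum_fun_apply)

lemma coordinate_frame_metric_right:
  assumes F: "coordinate_frame N E h" and g: "riemannian_metric A g" and x: "x \<in> N"
    and v: "v \<in> tangent_space A x" and w: "w \<in> tangent_space A x"
  shows "g x v w = (\<Sum>j\<in>Basis. w (h j) * g x v (E j x))"
proof -
  have "g x v w = g x v (\<Sum>j\<in>Basis. w (h j) *\<^sub>R E j x)"
    by (rule arg_cong[OF coordinate_frameD(6)[OF F x w]])
  also have "\<dots> = (\<Sum>j\<in>Basis. w (h j) * g x v (E j x))"
    by (rule riemannian_metric_sum[where g = g, OF g v finite_Basis coordinate_frameD(4)[OF F]])
  finally show ?thesis .
qed

lemma coordinate_frame_metric_left: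
  assumes F: "coordinate_frame N E h" and g: "riemannian_metric A g" and x: "x \<in> N"
    and v: "v \<in> tangent_space A x" and w: "w \<in> tangent_space A x"
  shows "g x v w = (\<Sum>i\<in>Basis. v (h i) * g x (E i x) w)"
  using coordinate_frame_metric_right[where g = g, OF F g x w v]
    riemannian_metric_sym[where g = g, OF g v w]
    riemannian_metric_sym[where g = g, OF g w coordinate_frameD(4)[OF F]] by simp

lemma coordinate_frame_metric:
  assumes F: "coordinate_frame N E h" and g: "riemannian_metric A g" and x: "x \<in> N"
    and v: "v \<in> tangent_space A x" and w: "w \<in> tangent_space A x"
  shows "g x v w = (\<Sum>i\<in>Basis. \<Sum>j\<in>Basis. g x (E i x) (E j x) * v (h i) * w (h j))"
  using coordinate_frame_metric_left[where g = g, OF assms]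
    coordinate_frame_metric_right[where g = g, OF F g x coordinate_frameD(4)[OF F] w]
  by (simp add: sum_distrib_left mult_ac)

lemma killing_in_coordinates:
  assumes F: "coordinate_frame N E h" and g: "riemannian_metric A g" and p: "p \<in> N"
    and X: "vector_field A X"
    and killing: "\<And>V W. vector_field A V \<Longrightarrow> vector_field A W \<Longrightarrow> lie_derivative_metric X g V W p = 0"
    and v: "v \<in> tangent_space A p" and w: "w \<in> tangent_space A p"
  shows "(\<Sum>i\<in>Basis. \<Sum>j\<in>Basis. X p (\<lambda>x. g x (E i x) (E j x)) * v (h i) * w (h j)) +
    (\<Sum>i\<in>Basis. \<Sum>j\<in>Basis. g p (E i p) (E j p) * v (\<lambda>x. X x (h i)) * w (h j)) +
    (\<Sum>i\<in>Basis. \<Sum>j\<in>Basis. g p (E i p) (E j p) * v (h i) * w (\<lambda>x. X x (h j))) = 0"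
proof -
  note XT = vector_field_tangent[OF X] and E = coordinate_frameD[OF F]
  define e where "e i k = E i p (\<lambda>x. X x (h k))" for i k
  define G where "G i j = g p (E i p) (E j p)" for i j
  have bracket: "lie_bracket X (E i) p (h k) = - e i k" if "i \<in> Basis" "k \<in> Basis" for i k
  proof -
    have "X p (\<lambda>x. E i x (h k)) = X p (\<lambda>x. of_bool (i = k))"
      using that by (intro tangent_local[OF XT _ _ E(1) p] vector_field_smooth[OF E(2)] E(3,5)
          smooth_fun_const)
    also have "\<dots> = 0" by (rule tangent_const[OF XT])
    finally show ?thesis by (simp add: lie_bracket_def e_def)
  qed
  have X_G: "X p (\<lambda>x. g x (E i x) (E j x)) =
      - (\<Sum>k\<in>Basis. e i k * G k j) - (\<Sum>k\<in>Basis. e j k * G i k)"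
    if i: "i \<in> Basis" and j: "j \<in> Basis" for i j
  proof -
    have LT: "lie_bracket X (E l) p \<in> tangent_space A p" for l
      by (rule lie_bracket_tangent[OF X E(2)])
    have "g p (lie_bracket X (E i) p) (E j p) = - (\<Sum>k\<in>Basis. e i k * G k j)"
      using coordinate_frame_metric_left[where g = g, OF F g p LT[of i] E(4)[of j]] bracket[OF i]
      by (simp add: G_def sum_negf)
    moreover have "g p (E i p) (lie_bracket X (E j) p) = - (\<Sum>k\<in>Basis. e j k * G i k)"
      using coordinate_frame_metric_right[where g = g, OF F g p E(4)[of i] LT[of j]] bracket[OF j]
      by (simp add: G_def sum_negf)
    ultimately show ?thesis
      using killing[OF E(2) E(2), of i j] by (simp add: lie_derivative_metric_def)
  qed
  have vX: "u (\<lambda>x. X x (h i)) = (\<Sum>k\<in>Basis. u (h k) * e k i)" if "u \<in> tangent_space A p" for u i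
    unfolding e_def by (rule coordinate_frame_apply[OF F p that])
  have "(\<Sum>i\<in>Basis. \<Sum>j\<in>Basis. \<Sum>k\<in>Basis. e i k * G k j * v (h i) * w (h j)) =
      (\<Sum>k\<in>Basis. \<Sum>j\<in>Basis. \<Sum>i\<in>Basis. e i k * G k j * v (h i) * w (h j))"
  proof -
    have "(\<Sum>i\<in>Basis. \<Sum>j\<in>Basis. \<Sum>k\<in>Basis. e i k * G k j * v (h i) * w (h j)) =
        (\<Sum>j\<in>Basis. \<Sum>i\<in>Basis. \<Sum>k\<in>Basis. e i k * G k j * v (h i) * w (h j))"
      by (rule sum.swap)
    also have "\<dots> = (\<Sum>j\<in>Basis. \<Sum>k\<in>Basis. \<Sum>i\<in>Basis. e i k * G k j * v (h i) * w (h j))"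
      by (rule sum.cong[OF refl], rule sum.swap)
    also have "\<dots> = (\<Sum>k\<in>Basis. \<Sum>j\<in>Basis. \<Sum>i\<in>Basis. e i k * G k j * v (h i) * w (h j))"
      by (rule sum.swap)
    finally show ?thesis .
  qed
  moreover have "(\<Sum>i\<in>Basis. \<Sum>j\<in>Basis. \<Sum>k\<in>Basis. e j k * G i k * v (h i) * w (h j)) =
      (\<Sum>i\<in>Basis. \<Sum>k\<in>Basis. \<Sum>j\<in>Basis. e j k * G i k * v (h i) * w (h j))"
    by (rule sum.cong[OF refl], rule sum.swap)
  moreover have "(\<Sum>i\<in>Basis. \<Sum>j\<in>Basis. X p (\<lambda>x. g x (E i x) (E j x)) * v (h i) * w (h j)) =
      - (\<Sum>i\<in>Basis. \<Sum>j\<in>Basis. \<Sum>k\<in>Basis. e i k * G k j * v (h i) * w (h j))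
      - (\<Sum>i\<in>Basis. \<Sum>j\<in>Basis. \<Sum>k\<in>Basis. e j k * G i k * v (h i) * w (h j))"
    by (simp add: X_G left_diff_distrib sum_distrib_right sum_negf sum_subtractf)
  moreover have "(\<Sum>i\<in>Basis. \<Sum>j\<in>Basis. g p (E i p) (E j p) * v (\<lambda>x. X x (h i)) * w (h j)) =
      (\<Sum>k\<in>Basis. \<Sum>j\<in>Basis. \<Sum>i\<in>Basis. e i k * G k j * v (h i) * w (h j))"
    by (simp add: vX[OF v] G_def sum_distrib_left sum_distrib_right mult_ac)
  moreover have "(\<Sum>i\<in>Basis. \<Sum>j\<in>Basis. g p (E i p) (E j p) * v (h i) * w (\<lambda>x. X x (h j))) =
      (\<Sum>i\<in>Basis. \<Sum>k\<in>Basis. \<Sum>j\<in>Basis. e j k * G i k * v (h i) * w (h j))"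
    by (simp add: vX[OF w] G_def sum_distrib_left sum_distrib_right mult_ac)
  ultimately show ?thesis by linarith
qed

end

locale smooth_manifold_map = A: smooth_manifold A + B: smooth_manifold B
  for A :: "('a::{t2_space, second_countable_topology}, 'e::euclidean_space) atlas"
    and B :: "('b::{t2_space, second_countable_topology}, 'd::euclidean_space) atlas" +
  fixes \<iota> :: "'b \<Rightarrow> 'a"
  assumes smooth: "smooth_map B A \<iota>"
begin

lemma open_preimage: "open N \<Longrightarrow> open (\<iota> -` N)"
  using smooth open_vimage by (auto simp: smooth_map_def)

lemma smooth_fun_compose:
  assumes f: "smooth_fun A f"
  shows "smooth_fun B (f \<circ> \<iota>)"
proof (rule B.smooth_funI)
  fix V d y
  assume V: "(V, d) \<in> B" and y: "y \<in> V"
  obtain U c where U: "(U, c) \<in> A" "\<iota> y \<in> U" by (rule A.chart_at)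
  let ?W = "V \<inter> \<iota> -` U"
  have W: "open ?W"
    using B.open_chart[OF V] open_preimage[OF A.open_chart[OF U(1)]] by blast
  have dW: "open (d ` ?W)"
    using B.open_chart_image[OF V W] by auto
  have "smooth_on (d ` ?W) (c \<circ> \<iota> \<circ> inv_into V d)"
    using smooth V U(1) by (fastforce simp: smooth_map_def)
  moreover have "(c \<circ> \<iota> \<circ> inv_into V d) ` d ` ?W \<subseteq> c ` U"
    by (auto simp: B.inv_into_chart[OF V])
  ultimately have "smooth_on (d ` ?W) (\<lambda>x. (f \<circ> inv_into U c) ((c \<circ> \<iota> \<circ> inv_into V d) x))"
    using smooth_on_compose[OF dW A.open_chart_range[OF U(1)] _ A.smooth_fun_chart[OF f U(1)]]
    by blast
  then have "smooth_on (d ` ?W) (f \<circ> \<iota> \<circ> inv_into V d)"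
    by (rule smooth_on_cong[OF dW, rotated])
      (auto simp: B.inv_into_chart[OF V] A.inv_into_chart[OF U(1)])
  then show "\<exists>W. open W \<and> y \<in> W \<and> W \<subseteq> V \<and> smooth_on (d ` W) (f \<circ> \<iota> \<circ> inv_into V d)"
    using W y U(2) by (intro exI[of _ ?W]) auto
qed

lemma pushforward_apply: "smooth_fun A f \<Longrightarrow> pushforward A \<iota> v f = v (f \<circ> \<iota>)"
  by (simp add: pushforward_def)

lemma pushforward_tangent:
  assumes v: "v \<in> tangent_space B q"
  shows "pushforward A \<iota> v \<in> tangent_space A (\<iota> q)"
  unfolding tangent_space_def
proof (intro CollectI conjI allI impI)
  fix f
  assume "\<not> smooth_fun A f"
  then show "pushforward A \<iota> v f = 0" by (simp add: pushforward_def)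
next
  fix f h a b
  assume f: "smooth_fun A f" and h: "smooth_fun A h"
  then have "smooth_fun A (\<lambda>x. a * f x + b * h x)"
    by (intro A.smooth_fun_add A.smooth_fun_mult A.smooth_fun_const)
  then show "pushforward A \<iota> v (\<lambda>x. a * f x + b * h x) = a * pushforward A \<iota> v f + b * pushforward A \<iota> v h"
    using B.tangent_linear[OF v smooth_fun_compose[OF f] smooth_fun_compose[OF h]] f h
    by (simp add: pushforward_apply o_def)
next
  fix f h
  assume f: "smooth_fun A f" and h: "smooth_fun A h"
  then show "pushforward A \<iota> v (\<lambda>x. f x * h x) =
      f (\<iota> q) * pushforward A \<iota> v h + h (\<iota> q) * pushforward A \<iota> v f"
    using B.tangent_mult[OF v smooth_fun_compose[OF f] smooth_fun_compose[OF h]]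
      A.smooth_fun_mult[OF f h]
    by (simp add: pushforward_apply o_def)
qed

text \<open>\<open>\<iota>\<close> need not carry fields on the source to ambient fields, so the ambient Killing equation
  is used in coordinates at \<open>\<iota> q\<close>, where it only involves the values of the fields at that point.\<close>

lemma killing_pullback:
  assumes g: "riemannian_metric A g"
    and X: "vector_field A X" and X': "vector_field B X'"
    and related: "\<And>q. pushforward A \<iota> (X' q) = X (\<iota> q)"
    and killing: "\<And>V W p. vector_field A V \<Longrightarrow> vector_field A W \<Longrightarrow> lie_derivative_metric X g V W p = 0"
    and Y: "vector_field B Y" and Z: "vector_field B Z"
  shows "lie_derivative_metric X' (induced_metric A g \<iota>) Y Z q = 0"
proof -
  note X'T = B.vector_field_tangent[OF X']
  note YT = B.vector_field_tangent[OF Y] and ZT = B.vector_field_tangent[OF Z]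
  let ?g = "induced_metric A g \<iota>"
  have expand: "?g x v w = (\<Sum>i\<in>Basis. \<Sum>j\<in>Basis. g (\<iota> x) (E i (\<iota> x)) (E j (\<iota> x)) * v (h i \<circ> \<iota>) * w (h j \<circ> \<iota>))"
    if F: "A.coordinate_frame N E h" and "x \<in> \<iota> -` N" "v \<in> tangent_space B x" "w \<in> tangent_space B x"
    for N E h x v w
    using A.coordinate_frame_metric[where g = g, OF F g _ pushforward_tangent pushforward_tangent, of x v w] that
    by (simp add: induced_metric_def pushforward_apply A.coordinate_frameD(3)[OF F])
  have smooth_terms: "smooth_fun B (\<lambda>x. g (\<iota> x) (E i (\<iota> x)) (E j (\<iota> x)))"
    "smooth_fun B (\<lambda>x. Y x (h i \<circ> \<iota>))" "smooth_fun B (\<lambda>x. Z x (h i \<circ> \<iota>))"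
    if F: "A.coordinate_frame N E h" for N E h i j
    using smooth_fun_compose[OF riemannian_metric_smooth[OF g A.coordinate_frameD(2,2)[OF F]]]
      B.vector_field_smooth[OF Y smooth_fun_compose[OF A.coordinate_frameD(3)[OF F]]]
      B.vector_field_smooth[OF Z smooth_fun_compose[OF A.coordinate_frameD(3)[OF F]]]
    by (simp_all add: o_def)
  have smooth_sum: "smooth_fun B (\<lambda>x. \<Sum>i\<in>Basis. \<Sum>j\<in>Basis.
      g (\<iota> x) (E i (\<iota> x)) (E j (\<iota> x)) * Y x (h i \<circ> \<iota>) * Z x (h j \<circ> \<iota>))"
    if F: "A.coordinate_frame N E h" for N E h
    by (intro B.smooth_fun_sum B.smooth_fun_mult smooth_terms[OF F] finite_Basis)
  have smooth_g: "smooth_fun B (\<lambda>x. ?g x (Y x) (Z x))"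
  proof (rule B.smooth_fun_local)
    fix q
    obtain N E h where F: "A.coordinate_frame N E h" and q: "\<iota> q \<in> N"
      by (rule A.coordinate_frame_at)
    show "\<exists>W F. open W \<and> q \<in> W \<and> smooth_fun B F \<and> (\<forall>x\<in>W. ?g x (Y x) (Z x) = F x)"
      using open_preimage[OF A.coordinate_frameD(1)[OF F]] q smooth_sum[OF F] expand[OF F _ YT ZT]
      by (intro exI[of _ "\<iota> -` N"] exI conjI ballI) auto
  qed
  obtain N E h where F: "A.coordinate_frame N E h" and q: "\<iota> q \<in> N"
    by (rule A.coordinate_frame_at)
  note E = A.coordinate_frameD[OF F]
  let ?v = "pushforward A \<iota> (Y q)" and ?w = "pushforward A \<iota> (Z q)"
  let ?G = "\<lambda>i j. g (\<iota> q) (E i (\<iota> q)) (E j (\<iota> q))"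
  have X'_comp: "X' x (f \<circ> \<iota>) = X (\<iota> x) f" if "smooth_fun A f" for f x
    using that related[of x] by (metis pushforward_apply)
  have bracket: "lie_bracket X' U q (h i \<circ> \<iota>) =
      X' q (\<lambda>x. U x (h i \<circ> \<iota>)) - pushforward A \<iota> (U q) (\<lambda>x. X x (h i))" for U i
    by (simp only: lie_bracket_def X'_comp[OF E(3)]
        pushforward_apply[OF A.vector_field_smooth[OF X E(3)]]) (simp only: o_def)
  have X'_G: "X' q (\<lambda>x. g (\<iota> x) (E i (\<iota> x)) (E j (\<iota> x))) =
      X (\<iota> q) (\<lambda>x. g x (E i x) (E j x))" for i j
    using X'_comp[OF riemannian_metric_smooth[OF g E(2) E(2)]] by (simp add: o_def)
  have "X' q (\<lambda>x. ?g x (Y x) (Z x)) = X' q (\<lambda>x. \<Sum>i\<in>Basis. \<Sum>j\<in>Basis.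
      g (\<iota> x) (E i (\<iota> x)) (E j (\<iota> x)) * Y x (h i \<circ> \<iota>) * Z x (h j \<circ> \<iota>))"
    using q by (intro B.tangent_local[OF X'T smooth_g smooth_sum[OF F] open_preimage[OF E(1)]]
        expand[OF F _ YT ZT]) auto
  also have "\<dots> = (\<Sum>i\<in>Basis. \<Sum>j\<in>Basis. X' q (\<lambda>x.
      g (\<iota> x) (E i (\<iota> x)) (E j (\<iota> x)) * Y x (h i \<circ> \<iota>) * Z x (h j \<circ> \<iota>)))"
    by (simp add: B.tangent_sum[OF X'T] B.smooth_fun_sum B.smooth_fun_mult smooth_terms[OF F])
  also have "\<dots> = (\<Sum>i\<in>Basis. \<Sum>j\<in>Basis.
      X (\<iota> q) (\<lambda>x. g x (E i x) (E j x)) * ?v (h i) * ?w (h j) +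
      ?G i j * X' q (\<lambda>x. Y x (h i \<circ> \<iota>)) * ?w (h j) +
      ?G i j * ?v (h i) * X' q (\<lambda>x. Z x (h j \<circ> \<iota>)))"
    by (simp add: B.tangent_mult[OF X'T] B.smooth_fun_mult smooth_terms[OF F] pushforward_apply E(3)
        X'_G algebra_simps)
  finally have "lie_derivative_metric X' ?g Y Z q =
      (\<Sum>i\<in>Basis. \<Sum>j\<in>Basis. X (\<iota> q) (\<lambda>x. g x (E i x) (E j x)) * ?v (h i) * ?w (h j)) +
      (\<Sum>i\<in>Basis. \<Sum>j\<in>Basis. ?G i j * ?v (\<lambda>x. X x (h i)) * ?w (h j)) +
      (\<Sum>i\<in>Basis. \<Sum>j\<in>Basis. ?G i j * ?v (h i) * ?w (\<lambda>x. X x (h j)))"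
    using q B.lie_bracket_tangent[OF X' Y, of q] B.lie_bracket_tangent[OF X' Z, of q]
    by (simp add: lie_derivative_metric_def expand[OF F] YT ZT bracket pushforward_apply[OF E(3)]
        sum.distrib sum_subtractf algebra_simps)
  also have "\<dots> = 0"
    by (intro A.killing_in_coordinates[where g = g, OF F g q X killing] pushforward_tangent YT ZT)
  finally show ?thesis .
qed

end

context generalized_sasakian_space_form
begin

lemma phi_skew:
  assumes v: "v \<in> tangent_space A p" and w: "w \<in> tangent_space A p"
  shows "g p (\<phi> p v) w = - g p v (\<phi> p w)"
proof -
  interpret smooth_manifold A by unfold_locales (rule atlas)
  have xi: "\<xi> p \<in> tangent_space A p"
    using xi_field by (rule vector_field_tangent)
  note T = phi_tangent[OF v] phi_tangent[OF w]
  have "g p (\<phi> p v) (\<phi> p (\<phi> p w)) = g p v (\<phi> p w)"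
    using g_phi_phi[OF v T(2)] eta_phi[OF w] by simp
  moreover have "\<phi> p (\<phi> p w) = \<eta> p w *\<^sub>R \<xi> p - w"
    using phi_phi[OF w] by simp
  moreover have "g p (\<phi> p v) (\<eta> p w *\<^sub>R \<xi> p - w) = - g p (\<phi> p v) w"
    using riemannian_metric_diff[where g = g, OF metric T(1) tangent_space_scaleR[OF xi] w]
      riemannian_metric_scaleR[where g = g, OF metric T(1) xi] g_xi[OF T(1)] eta_phi[OF v] by simp
  ultimately show ?thesis by simp
qed

lemma xi_killing:
  assumes V: "vector_field A V" and W: "vector_field A W"
  shows "lie_derivative_metric \<xi> g V W p = 0"
proof -
  interpret smooth_manifold A by unfold_locales (rule atlas)
  have D: "vector_field A (D X Y)" if "vector_field A X" "vector_field A Y" for X Y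
    using connection that by (simp add: levi_civita_def affine_connection_def)
  have bracket: "lie_bracket \<xi> U p = D \<xi> U p - D U \<xi> p" if U: "vector_field A U" for U
  proof -
    have "D \<xi> U - D U \<xi> = lie_bracket \<xi> U"
      using connection xi_field U by (simp add: levi_civita_def)
    then show ?thesis by (metis minus_apply)
  qed
  note T = vector_field_tangent[of _ p]
  have nabla: "g p u (D U \<xi> p) = - ((f1 p - f3 p) * g p u (\<phi> p (U p)))"
    if u: "u \<in> tangent_space A p" and U: "vector_field A U" for u U
    by (simp only: nabla_xi[OF U] scaleR_minus_left[symmetric] mult_minus_left
        riemannian_metric_scaleR[where g = g, OF metric u phi_tangent[OF T[OF U]]])
  have "\<xi> p (\<lambda>q. g q (V q) (W q)) = g p (D \<xi> V p) (W p) + g p (V p) (D \<xi> W p)"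
    using connection V W xi_field by (simp add: levi_civita_def)
  moreover have "g p (lie_bracket \<xi> V p) (W p) = g p (D \<xi> V p) (W p) - g p (W p) (D V \<xi> p)"
    using riemannian_metric_diff[where g = g, OF metric T[OF W] T[OF D[OF xi_field V]] T[OF D[OF V xi_field]]]
      riemannian_metric_sym[where g = g, OF metric T[OF W]] bracket[OF V] T D V W xi_field
      lie_bracket_tangent[OF xi_field V, of p]
    by simp
  moreover have "g p (V p) (lie_bracket \<xi> W p) = g p (V p) (D \<xi> W p) - g p (V p) (D W \<xi> p)"
    using riemannian_metric_diff[where g = g, OF metric T[OF V] T[OF D[OF xi_field W]] T[OF D[OF W xi_field]]]
      bracket[OF W] by simp
  moreover have "g p (W p) (D V \<xi> p) + g p (V p) (D W \<xi> p) = 0"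
    using nabla[OF T[OF W] V] nabla[OF T[OF V] W] phi_skew[OF T[OF V] T[OF W]]
      riemannian_metric_sym[where g = g, OF metric T[OF W] phi_tangent[OF T[OF V]]] by simp
  ultimately show ?thesis by (simp add: lie_derivative_metric_def)
qed

end

theorem theorem5p1:
  fixes A :: "('a::{t2_space, second_countable_topology}, 'e::euclidean_space) atlas"
    and B :: "('b::{t2_space, second_countable_topology}, 'd::euclidean_space) atlas"
    and \<iota> :: "'b \<Rightarrow> 'a"
    and lam :: real
  assumes "generalized_sasakian_space_form A \<phi> \<xi> \<eta> g D n f1 f2 f3"
    and "invariant_submanifold A \<phi> \<xi> B \<iota>"
    and "levi_civita B (induced_metric A g \<iota>) D\<^sub>M"
    and "ricci_soliton B D\<^sub>M (induced_metric A g \<iota>) (restricted_field A B \<iota> \<xi>) lam"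
  shows "einstein B D\<^sub>M (induced_metric A g \<iota>)"
proof -
  interpret generalized_sasakian_space_form A \<phi> \<xi> \<eta> g D n f1 f2 f3 by fact
  interpret smooth_manifold_map A B \<iota>
    using atlas assms(2) by unfold_locales (auto simp: invariant_submanifold_def immersion_def)
  let ?X = "restricted_field A B \<iota> \<xi>"
  have X: "vector_field B ?X"
    using assms(4) by (simp add: ricci_soliton_def)
  have related: "pushforward A \<iota> (?X q) = \<xi> (\<iota> q)" for q
    using assms(2) f_the_inv_into_f[of "pushforward A \<iota>" "tangent_space B q" "\<xi> (\<iota> q)"]
    by (simp add: restricted_field_def invariant_submanifold_def immersion_def)
  have "ricci B D\<^sub>M Y Z q = - lam * induced_metric A g \<iota> q (Y q) (Z q)"
    if Y: "vector_field B Y" and Z: "vector_field B Z" for Y Z q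
  proof -
    have "lie_derivative_metric ?X (induced_metric A g \<iota>) Y Z q = 0"
      by (rule killing_pullback[OF metric xi_field X related xi_killing Y Z])
    moreover have "lie_derivative_metric ?X (induced_metric A g \<iota>) Y Z q + 2 * ricci B D\<^sub>M Y Z q +
        2 * lam * induced_metric A g \<iota> q (Y q) (Z q) = 0"
      using assms(4) Y Z by (simp add: ricci_soliton_def)
    ultimately show ?thesis by simp
  qed
  then show ?thesis
    unfolding einstein_def by blast
qed

end
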